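(* Let $n\ge2$ and let $A_1,\dots,A_{n-1}$ be positive definite hyperhermitian $n\times n$ quaternionic matrices. Then for any hyperhermitian $n\times n$ matrix $X$ $$\det(A_1,\dots,A_{n-1},X)^2\ \ge\ \det(A_1,\dots,A_{n-1},A_{n-1})\cdot\det(A_1,\dots,A_{n-2},X,X),$$ and equality holds if and only if the matrix $X$ is proportional to $A_{n-1}$.
   Context: $\mathbb{H}$ is the skew field of quaternions. A quaternionic square matrix $A=(a_{ij})$ is hyperhermitian if $a_{ij}=\overline{a_{ji}}$ for all $i,j$. It is positive definite if $\sum_{i,j}\bar x_i a_{ij}x_j>0$ for every non-zero $x\in\mathbb{H}^n$. "Proportional" means $X=\lambda A_{n-1}$ for some real $\lambda$. Moore determinant: for a hyperhermitian $n\times n$ matrix $A$ let ${}^{\mathbb R}A$ be the real $4n\times 4n$ matrix of the symmetric bilinear form $(x,y)\mapsto \mathrm{Re}\sum_{i,j}\bar x_i a_{ij}y_j$ on $\mathbb{H}^n\cong\mathbb{R}^{4n}$. There is a unique polynomial $P$ on the real vector space of hyperhermitian $n\times n$ matrices with $\det({}^{\mathbb R}A)=P(A)^4$ for all $A$ and $P(\mathrm{Id})=1$; the Moore determinant is $\det A:=P(A)\in\mathbb{R}$. (If $A=C^*\mathrm{diag}(\lambda_1,\dots,\lambda_n)C$ with $\lambda_i\in\mathbb{R}$ and $C^*C=\mathrm{Id}$, then $\det A=\prod_i\lambda_i$.) Mixed discriminant: for hyperhermitian $n\times n$ matrices $A_1,\dots,A_n$, $\det(A_1,\dots,A_n)$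 is $\frac{1}{n!}$ times the coefficient of $\lambda_1\cdots\lambda_n$ in the polynomial $\det(\lambda_1A_1+\dots+\lambda_nA_n)$ of the real variables $\lambda_1,\dots,\lambda_n$. *)

theory Defs
  imports "HOL-Analysis.Analysis" "HOL-Library.Poly_Mapping"
begin

section \<open>The skew field of quaternions\<close>

datatype quat = Quat (qRe: real) (qI: real) (qJ: real) (qK: real)

lemma quat_eq_iff: "x = y \<longleftrightarrow> qRe x = qRe y \<and> qI x = qI y \<and> qJ x = qJ y \<and> qK x = qK y"
  by (cases x; cases y) simp

instantiation quat :: ab_group_add
begin

definition "0 = Quat 0 0 0 0"
definition "x + y = Quat (qRe x + qRe y) (qI x + qI y) (qJ x + qJ y) (qK x + qK y)"
definition "- x = Quat (- qRe x) (- qI x) (- qJ x) (- qK x)"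
definition "x - y = Quat (qRe x - qRe y) (qI x - qI y) (qJ x - qJ y) (qK x - qK y)"

instance
  by standard
    (simp_all add: zero_quat_def plus_quat_def uminus_quat_def minus_quat_def quat_eq_iff)

end

lemma quat_zero_sel [simp]: "qRe 0 = 0" "qI 0 = 0" "qJ 0 = 0" "qK 0 = 0"
  by (simp_all add: zero_quat_def)

lemma quat_plus_sel [simp]:
  "qRe (x + y) = qRe x + qRe y" "qI (x + y) = qI x + qI y"
  "qJ (x + y) = qJ x + qJ y" "qK (x + y) = qK x + qK y"
  by (simp_all add: plus_quat_def)

lemma quat_uminus_sel [simp]:
  "qRe (- x) = - qRe x" "qI (- x) = - qI x" "qJ (- x) = - qJ x" "qK (- x) = - qK x"
  by (simp_all add: uminus_quat_def)

lemma quat_minus_sel [simp]: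
  "qRe (x - y) = qRe x - qRe y" "qI (x - y) = qI x - qI y"
  "qJ (x - y) = qJ x - qJ y" "qK (x - y) = qK x - qK y"
  by (simp_all add: minus_quat_def)

definition qcnj :: "quat \<Rightarrow> quat" where
  "qcnj x = Quat (qRe x) (- qI x) (- qJ x) (- qK x)"

lemma qcnj_sel [simp]:
  "qRe (qcnj x) = qRe x" "qI (qcnj x) = - qI x" "qJ (qcnj x) = - qJ x" "qK (qcnj x) = - qK x"
  by (simp_all add: qcnj_def)

instantiation quat :: real_algebra_1
begin

definition "1 = Quat 1 0 0 0"

definition "x * y = Quat
   (qRe x * qRe y - qI x * qI y - qJ x * qJ y - qK x * qK y)
   (qRe x * qI y + qI x * qRe y + qJ x * qK y - qK x * qJ y)
   (qRe x * qJ y - qI x * qK y + qJ x * qRe y + qK x * qI y)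
   (qRe x * qK y + qI x * qJ y - qJ x * qI y + qK x * qRe y)"

definition "scaleR r x = Quat (r * qRe x) (r * qI x) (r * qJ x) (r * qK x)"

instance
  by standard
    (simp_all add: one_quat_def times_quat_def scaleR_quat_def quat_eq_iff algebra_simps)

end

lemma quat_one_sel [simp]: "qRe 1 = 1" "qI 1 = 0" "qJ 1 = 0" "qK 1 = 0"
  by (simp_all add: one_quat_def)

lemma quat_times_sel [simp]:
  "qRe (x * y) = qRe x * qRe y - qI x * qI y - qJ x * qJ y - qK x * qK y"
  "qI (x * y) = qRe x * qI y + qI x * qRe y + qJ x * qK y - qK x * qJ y"
  "qJ (x * y) = qRe x * qJ y - qI x * qK y + qJ x * qRe y + qK x * qI y"
  "qK (x * y) = qRe x * qK y + qI x * qJ y - qJ x * qI y + qK x * qRe y"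
  by (simp_all add: times_quat_def)

lemma quat_scaleR_sel [simp]:
  "qRe (r *\<^sub>R x) = r * qRe x" "qI (r *\<^sub>R x) = r * qI x"
  "qJ (r *\<^sub>R x) = r * qJ x" "qK (r *\<^sub>R x) = r * qK x"
  by (simp_all add: scaleR_quat_def)

instantiation quat :: real_inner
begin

definition inner_quat_def:
  "inner x y = qRe x * qRe y + qI x * qI y + qJ x * qJ y + qK x * qK y"

definition norm_quat_def: "norm (x :: quat) = sqrt (inner x x)"
definition sgn_quat_def: "sgn (x :: quat) = x /\<^sub>R norm x"
definition dist_quat_def: "dist (x :: quat) y = norm (x - y)"

definition uniformity_quat_def [code del]:
  "(uniformity :: (quat \<times> quat) filter) = (INF e\<in>{0 <..}. principal {(x, y). dist x y < e})"

definition open_quat_def [code del]: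
  "open (U :: quat set) \<longleftrightarrow> (\<forall>x\<in>U. eventually (\<lambda>(x', y). x' = x \<longrightarrow> y \<in> U) uniformity)"

instance
proof
  fix x y z :: quat and r :: real
  show "inner x y = inner y x"
    by (simp add: inner_quat_def mult.commute)
  show "inner (x + y) z = inner x z + inner y z"
    by (simp add: inner_quat_def algebra_simps)
  show "inner (scaleR r x) y = r * inner x y"
    by (simp add: inner_quat_def algebra_simps)
  show "0 \<le> inner x x"
    by (simp add: inner_quat_def)
  show "inner x x = 0 \<longleftrightarrow> x = 0"
    by (auto simp add: inner_quat_def quat_eq_iff add_nonneg_eq_0_iff)
qed (rule norm_quat_def sgn_quat_def dist_quat_def open_quat_def uniformity_quat_def)+

end

instantiation quat :: real_normed_div_algebra
begin

definition "inverse x = qcnj x /\<^sub>R (inner x x)" for x :: quat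
definition "x div y = x * inverse y" for x y :: quat

instance
proof
  fix x y :: quat
  have cnj: "qcnj x * x = inner x x *\<^sub>R 1" "x * qcnj x = inner x x *\<^sub>R 1"
    by (simp_all add: quat_eq_iff inner_quat_def)
  show "inverse x * x = 1" if "x \<noteq> 0"
    using that by (simp add: inverse_quat_def cnj)
  show "x * inverse x = 1" if "x \<noteq> 0"
    using that by (simp add: inverse_quat_def cnj)
  show "x div y = x * inverse y"
    by (rule divide_quat_def)
  show "inverse (0 :: quat) = 0"
    by (simp add: inverse_quat_def)
  have "inner (x * y) (x * y) = inner x x * inner y y"
    by (simp add: inner_quat_def algebra_simps)
  then show "norm (x * y) = norm x * norm y"
    by (simp add: norm_quat_def real_sqrt_mult)
qed

end

definition quat_unit :: "4 \<Rightarrow> quat" where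
  "quat_unit k =
     (if k = 1 then 1 else if k = 2 then Quat 0 1 0 0
      else if k = 3 then Quat 0 0 1 0 else Quat 0 0 0 1)"

section \<open>Hyperhermitian matrices\<close>

definition hyperhermitian :: "quat^'n^'n \<Rightarrow> bool" where
  "hyperhermitian A \<longleftrightarrow> (\<forall>i j. A $ i $ j = qcnj (A $ j $ i))"

definition quat_form :: "quat^'n^'n \<Rightarrow> quat^'n \<Rightarrow> quat^'n \<Rightarrow> quat" where
  "quat_form A x y = (\<Sum>i\<in>UNIV. \<Sum>j\<in>UNIV. qcnj (x $ i) * A $ i $ j * y $ j)"

text \<open>
  A quaternion counts as positive if it is a positive real number; the form value is
  automatically real when \<open>A\<close> is hyperhermitian.
\<close>

definition positive_definite :: "quat^'n^'n \<Rightarrow> bool" where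
  "positive_definite A \<longleftrightarrow> (\<forall>x. x \<noteq> 0 \<longrightarrow> (\<exists>r>0. quat_form A x x = of_real r))"

section \<open>The Moore determinant\<close>

text \<open>
  The Gram matrix of \<open>(x, y) \<mapsto> Re (quat_form A x y)\<close> in the real basis \<open>axis i u\<close>,
  \<open>u\<close> one of the four quaternion units.
\<close>

definition realification :: "quat^'n^'n \<Rightarrow> real^('n \<times> 4)^('n \<times> 4)" where
  "realification A = (\<chi> p q.
     qRe (quat_form A (axis (fst p) (quat_unit (snd p))) (axis (fst q) (quat_unit (snd q)))))"

text \<open>
  Polynomials on the real vector space of hyperhermitian matrices are exactly the restrictions
  of polynomials on all quaternionic matrices. Such an extension is not unique, but its values
  on hyperhermitian matrices are, so \<open>moore_det\<close> is meaningful on these only.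
\<close>

definition moore_polynomial :: "(quat^'n^'n \<Rightarrow> real) \<Rightarrow> bool" where
  "moore_polynomial P \<longleftrightarrow>
     real_polynomial_function P \<and>
     (\<forall>A. hyperhermitian A \<longrightarrow> det (realification A) = P A ^ 4) \<and>
     P (mat 1) = 1"

definition moore_det :: "quat^'n^'n \<Rightarrow> real" where
  "moore_det A = (THE d. \<exists>P. moore_polynomial P \<and> P A = d)"

section \<open>The mixed discriminant\<close>

text \<open>
  A polynomial in the variables \<open>l 0, l 1, l 2, \<dots>\<close> is the finitely supported map from exponent
  vectors to coefficients.
\<close>

definition mpoly_eval :: "((nat \<Rightarrow>\<^sub>0 nat) \<Rightarrow>\<^sub>0 real) \<Rightarrow> (nat \<Rightarrow> real) \<Rightarrow> real" where
  "mpoly_eval p l =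
     (\<Sum>m\<in>Poly_Mapping.keys p. Poly_Mapping.lookup p m *
        (\<Prod>i\<in>Poly_Mapping.keys m. l i ^ Poly_Mapping.lookup m i))"

text \<open>
  \<open>mixed_discriminant A\<close> is the mixed discriminant of \<open>A 1, \<dots>, A n\<close> with \<open>n = CARD('n)\<close>; values
  of \<open>A\<close> at other indices are irrelevant.
\<close>

definition mixed_discriminant :: "(nat \<Rightarrow> quat^'n^'n) \<Rightarrow> real" where
  "mixed_discriminant A =
     Poly_Mapping.lookup
       (THE p. \<forall>l. mpoly_eval p l = moore_det (\<Sum>i=1..CARD('n). l i *\<^sub>R A i))
       (\<Sum>i=1..CARD('n). Poly_Mapping.single i 1)
     / fact CARD('n)"

end

theory Submission
  imports Defs "HOL-Computational_Algebra.Fundamental_Theorem_Algebra"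
begin

text \<open>
  The Moore determinant \<open>h\<close> is a hyperbolic polynomial, and the inequality is the reversed
  Cauchy-Schwarz inequality for the quadratic form that is left when such a polynomial is
  polarized in all but two of its arguments.

  \<^bold>\<open>The polynomial.\<close>  The Moore polynomial is built by induction on the size of a principal
  block.  If \<open>a\<close> is a real diagonal entry, \<open>v\<close> the rest of its column and \<open>B\<close> the remaining block,
  then for \<open>a \<noteq> 0\<close> the Schur complement gives \<open>det = a^4 P(B - v v* / a)^4\<close>.  The left-hand side
  stays bounded as \<open>a\<close> tends to \<open>0\<close>, so \<open>t \<mapsto> P(B + t v v*)\<close> grows at most linearly.  It is
  therefore affine, and \<open>a P(B - v v* / a) = (a + 1) P(B) - P(B + v v*)\<close> is a polynomial
  (\<open>moore_polynomial_principal_block\<close>).  Uniqueness holds because two polynomials with equal fourth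
  powers agree up to sign on every line through the identity matrix.  Hence the mixed discriminant
  \<open>D\<close> is the normalized coefficient of an honest homogeneous polynomial.  Extracting that coefficient
  by finite differences gives an alternating sum of values of \<open>h\<close>
  (\<open>mixed_discriminant_alternating_sum\<close>), from which symmetry and multilinearity follow.

  \<^bold>\<open>The inequality.\<close>  If \<open>U\<close> is positive definite and \<open>W\<close> is hyperhermitian, then \<open>U + i W\<close> is
  nonsingular.  So \<open>h(z\<^sub>1 A\<^sub>1 + ... + z\<^sub>n A\<^sub>n)\<close> does not vanish when the \<open>z\<^sub>i\<close> that belong to positive
  definite matrices have nonnegative real parts, not all zero, and the one that belongs to \<open>X\<close> is
  purely imaginary.  A univariate polynomial with all its zeros in the open left half plane has a
  nonzero linear coefficient, by the argument of the Gauss-Lucas theorem; hence taking the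
  coefficient of \<open>z\<^sub>1\<close>, then of \<open>z\<^sub>2\<close>, and so on, preserves this nonvanishing
  (\<open>multilinear_part_nonzero\<close>).  After all but two variables have been removed, what remains is a
  multiple of \<open>z\<^sup>2 D(.., C, C) + 2 z w D(.., C, X) + w\<^sup>2 D(.., X, X)\<close>, where \<open>C\<close> stands for
  \<open>A\<^bsub>n-1\<^esub>\<close>.  Since it has no zero with \<open>Re z > 0\<close> and \<open>Re w = 0\<close>, its discriminant is
  nonnegative, and \<open>D(.., C, C) \<noteq> 0\<close> (\<open>mixed_discriminant_hyperbolic\<close>).

  \<^bold>\<open>Equality.\<close>  After subtracting a multiple of \<open>C\<close> from \<open>X\<close>, equality says that \<open>X\<close> is orthogonal
  to \<open>C\<close> and isotropic.  The form is semidefinite on the orthogonal complement of \<open>C\<close>, so \<open>X\<close> lies in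
  its kernel: \<open>D(A\<^sub>1, .., A\<^bsub>n-2\<^esub>, X, Y) = 0\<close> for all \<open>Y\<close>.  Perturbing one \<open>A\<^sub>i\<close> in both directions and
  using the inequality again shows that \<open>X\<close> remains in the kernel when \<open>A\<^sub>i\<close> is replaced by any other
  positive definite matrix (\<open>mixed_discriminant_kernel_replace\<close>).  So every mixed discriminant of
  positive definite matrices with one argument replaced by \<open>X\<close> vanishes.  Then \<open>h(1 + t X) = h(1)\<close>
  for small \<open>t\<close>, hence for all \<open>t\<close>.  A nonzero eigenvalue of the realification of \<open>X\<close> would make
  \<open>1 + t X\<close> singular for some \<open>t\<close>, so \<open>X = 0\<close> (\<open>mixed_discriminant_nondegenerate\<close>).
\<close>

section \<open>Polynomials in finitely many variables\<close>

definition monomial_eval :: "(nat \<Rightarrow> 'a) \<Rightarrow> (nat \<Rightarrow>\<^sub>0 nat) \<Rightarrow> 'a::comm_semiring_1" where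
  "monomial_eval l m = (\<Prod>i\<in>Poly_Mapping.keys m. l i ^ Poly_Mapping.lookup m i)"

lemma monomial_eval_superset:
  assumes "finite I" "Poly_Mapping.keys m \<subseteq> I"
  shows "monomial_eval l m = (\<Prod>i\<in>I. l i ^ Poly_Mapping.lookup m i)"
  unfolding monomial_eval_def
  by (rule prod.mono_neutral_left) (use assms in \<open>auto simp: in_keys_iff\<close>)

lemma monomial_eval_add: "monomial_eval l (m + k) = monomial_eval l m * monomial_eval l k"
proof -
  let ?I = "Poly_Mapping.keys m \<union> Poly_Mapping.keys k"
  have "finite ?I" "Poly_Mapping.keys (m + k) \<subseteq> ?I"
    using Poly_Mapping.keys_add[of m k] by auto
  then show ?thesis
    by (simp add: monomial_eval_superset[of ?I] lookup_add power_add prod.distrib)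
qed

lemma mpoly_eval_superset:
  assumes "finite K" "Poly_Mapping.keys p \<subseteq> K"
  shows "mpoly_eval p l = (\<Sum>m\<in>K. Poly_Mapping.lookup p m * monomial_eval l m)"
  unfolding mpoly_eval_def monomial_eval_def
  by (rule sum.mono_neutral_left) (use assms in \<open>auto simp: in_keys_iff\<close>)

lemma mpoly_eval_add: "mpoly_eval (p + q) l = mpoly_eval p l + mpoly_eval q l"
proof -
  let ?K = "Poly_Mapping.keys p \<union> Poly_Mapping.keys q"
  have "finite ?K" "Poly_Mapping.keys (p + q) \<subseteq> ?K"
    using Poly_Mapping.keys_add[of p q] by auto
  then show ?thesis
    by (simp add: mpoly_eval_superset[of ?K] lookup_add distrib_right sum.distrib)
qed

lemma mpoly_eval_zero [simp]: "mpoly_eval 0 l = 0"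
  by (simp add: mpoly_eval_def)

lemma mpoly_eval_single: "mpoly_eval (Poly_Mapping.single m c) l = c * monomial_eval l m"
  by (subst mpoly_eval_superset[of "{m}"]) auto

lemma mpoly_eval_sum: "mpoly_eval (\<Sum>a\<in>S. f a) l = (\<Sum>a\<in>S. mpoly_eval (f a) l)"
  by (induction S rule: infinite_finite_induct) (auto simp: mpoly_eval_add)

text \<open>
  Let the \<open>i\<close>-th variable be the \<open>e\<close>-th power of the \<open>i\<close>-th prime.  By unique factorization the
  monomials then take the values \<open>x\<^sub>m^e\<close> with distinct numbers \<open>x\<^sub>m\<close>.  As \<open>e\<close> varies, a linear
  combination of such powers vanishes only if all its coefficients do, as Lagrange interpolation at
  the points \<open>x\<^sub>m\<close> shows.
\<close>
lemma mpoly_eval_0_imp_0: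
  assumes "\<And>l. mpoly_eval p l = 0"
  shows "p = 0"
proof -
  let ?K = "Poly_Mapping.keys p"
  define P where "P = (\<lambda>i. enumerate {p::nat. prime p} i)"
  have prime_P: "prime (P i)" for i
    using enumerate_in_set[OF primes_infinite] by (auto simp: P_def)
  have inj_P: "inj P"
    unfolding P_def using strict_mono_enumerate[OF primes_infinite] strict_mono_imp_inj_on by blast
  define x where "x = (\<lambda>m. monomial_eval P m)"
  have mult_x: "multiplicity (P j) (x m) = Poly_Mapping.lookup m j" for m j
  proof -
    let ?S = "Poly_Mapping.keys m"
    have "x m = (\<Prod>q\<in>P ` ?S. q ^ Poly_Mapping.lookup m (inv P q))"
      unfolding x_def monomial_eval_def
      by (subst prod.reindex) (use inj_P in \<open>auto simp: inj_on_def\<close>)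
    moreover have "P j \<in> P ` ?S \<longleftrightarrow> j \<in> ?S"
      using inj_P by (auto simp: inj_on_def)
    moreover have "multiplicity (P j) (\<Prod>q\<in>P ` ?S. q ^ Poly_Mapping.lookup m (inv P q))
        = (if P j \<in> P ` ?S then Poly_Mapping.lookup m (inv P (P j)) else 0)"
      by (rule multiplicity_prod_prime_powers) (use prime_P in auto)
    ultimately show ?thesis
      using inj_P by (simp add: in_keys_iff)
  qed
  have inj_x: "m = k" if "x m = x k" for m k
    by (rule poly_mapping_eqI) (metis mult_x that)
  have pow: "(\<Sum>m\<in>?K. Poly_Mapping.lookup p m * real (x m) ^ e) = 0" for e
  proof -
    have "monomial_eval (\<lambda>i. real (P i) ^ e) m = real (x m) ^ e" for m
      by (simp add: x_def monomial_eval_def prod_power_distrib mult.commute flip: power_mult)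
    then show ?thesis
      using assms[of "\<lambda>i. real (P i) ^ e"] by (simp add: mpoly_eval_superset[of ?K])
  qed
  have polyz: "(\<Sum>m\<in>?K. Poly_Mapping.lookup p m * poly q (real (x m))) = 0" for q
  proof -
    have "(\<Sum>m\<in>?K. Poly_Mapping.lookup p m * poly q (real (x m)))
        = (\<Sum>e\<le>degree q. coeff q e * (\<Sum>m\<in>?K. Poly_Mapping.lookup p m * real (x m) ^ e))"
      by (simp add: poly_altdef sum_distrib_left mult_ac sum.swap[of _ ?K])
    then show ?thesis by (simp add: pow)
  qed
  have "k \<notin> ?K" for k
  proof
    assume k: "k \<in> ?K"
    \<comment> \<open>The Lagrange polynomial that isolates the node belonging to \<open>k\<close>.\<close>
    define q where "q = (\<Prod>m\<in>?K - {k}. [:- real (x m), 1:])"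
    have q0: "poly q (real (x m)) = 0" if "m \<in> ?K - {k}" for m
      using that by (auto simp: q_def poly_prod)
    have qk: "poly q (real (x k)) \<noteq> 0"
      using inj_x by (auto simp: q_def poly_prod)
    have "0 = Poly_Mapping.lookup p k * poly q (real (x k))"
      using polyz[of q] k q0 by (subst (asm) sum.remove[of _ k]) auto
    with qk k show False by (auto simp: in_keys_iff)
  qed
  then show ?thesis by (metis keys_eq_empty all_not_in_conv)
qed

lemma mpoly_eval_uminus: "mpoly_eval (- p) l = - mpoly_eval p l"
  by (simp add: mpoly_eval_def sum_negf)

lemma mpoly_eval_inj:
  assumes "\<And>l. mpoly_eval p l = mpoly_eval q l"
  shows "p = q"
proof -
  have "mpoly_eval (p + - q) l = 0" for l
    by (simp add: mpoly_eval_add mpoly_eval_uminus assms del: add_uminus_conv_diff)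
  then have "p + - q = 0" by (rule mpoly_eval_0_imp_0)
  then show ?thesis by (metis eq_neg_iff_add_eq_0 minus_minus)
qed

lemma mpoly_linear_substitution:
  fixes P :: "'v::real_normed_vector \<Rightarrow> real" and B :: "nat \<Rightarrow> 'v"
  assumes "real_polynomial_function P" "finite I"
  shows "\<exists>p. (\<forall>m\<in>Poly_Mapping.keys p. Poly_Mapping.keys m \<subseteq> I) \<and>
             (\<forall>l. mpoly_eval p l = P (\<Sum>i\<in>I. l i *\<^sub>R B i))"
  using assms(1)
proof induction
  case (linear f)
  interpret bounded_linear f by fact
  let ?p = "\<Sum>i\<in>I. Poly_Mapping.single (Poly_Mapping.single i (1::nat)) (f (B i))"
  have "\<forall>l. mpoly_eval ?p l = f (\<Sum>i\<in>I. l i *\<^sub>R B i)"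
    by (simp add: mpoly_eval_sum mpoly_eval_single monomial_eval_def sum scaleR mult.commute)
  moreover have "\<forall>m\<in>Poly_Mapping.keys ?p. Poly_Mapping.keys m \<subseteq> I"
    using keys_sum[of "\<lambda>i. Poly_Mapping.single (Poly_Mapping.single i (1::nat)) (f (B i))" I]
    by (auto split: if_splits)
  ultimately show ?case by blast
next
  case (const c)
  show ?case
    by (rule exI[of _ "Poly_Mapping.single 0 c"]) (auto simp: mpoly_eval_single monomial_eval_def)
next
  case (add f g)
  then obtain p q where
    "\<forall>m\<in>Poly_Mapping.keys p. Poly_Mapping.keys m \<subseteq> I"
    "\<forall>m\<in>Poly_Mapping.keys q. Poly_Mapping.keys m \<subseteq> I"
    "\<forall>l. mpoly_eval p l = f (\<Sum>i\<in>I. l i *\<^sub>R B i)"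
    "\<forall>l. mpoly_eval q l = g (\<Sum>i\<in>I. l i *\<^sub>R B i)" by blast
  then show ?case
    using Poly_Mapping.keys_add[of p q]
    by (intro exI[of _ "p + q"]) (force simp: mpoly_eval_add)
next
  case (mult f g)
  then obtain p q where pq:
    "\<forall>m\<in>Poly_Mapping.keys p. Poly_Mapping.keys m \<subseteq> I"
    "\<forall>m\<in>Poly_Mapping.keys q. Poly_Mapping.keys m \<subseteq> I"
    "\<forall>l. mpoly_eval p l = f (\<Sum>i\<in>I. l i *\<^sub>R B i)"
    "\<forall>l. mpoly_eval q l = g (\<Sum>i\<in>I. l i *\<^sub>R B i)" by blast
  define s where "s = (\<lambda>(m, k). Poly_Mapping.single (m + k) (Poly_Mapping.lookup p m * Poly_Mapping.lookup q k))"
  let ?K = "Poly_Mapping.keys p \<times> Poly_Mapping.keys q"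
  have "mpoly_eval (\<Sum>a\<in>?K. s a) l = mpoly_eval p l * mpoly_eval q l" for l
    by (simp add: mpoly_eval_sum s_def mpoly_eval_single monomial_eval_add case_prod_unfold
        mpoly_eval_superset[of "Poly_Mapping.keys p"] mpoly_eval_superset[of "Poly_Mapping.keys q"]
        sum_product sum.cartesian_product mult_ac)
  moreover have "Poly_Mapping.keys m \<subseteq> I" if m: "m \<in> Poly_Mapping.keys (\<Sum>a\<in>?K. s a)" for m
  proof -
    obtain a where "a \<in> ?K" "m \<in> Poly_Mapping.keys (s a)"
      using m keys_sum[of s ?K] by blast
    then obtain m1 m2 where "m1 \<in> Poly_Mapping.keys p" "m2 \<in> Poly_Mapping.keys q" "m = m1 + m2"
      by (auto simp: s_def split: if_splits)
    then show ?thesis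
      using pq(1,2) Poly_Mapping.keys_add[of m1 m2] by blast
  qed
  ultimately show ?case
    using pq by (intro exI[of _ "\<Sum>a\<in>?K. s a"]) auto
qed

text \<open>
  The scaling law for the single factor 2 already forces every monomial to have degree \<open>n\<close>: scaling
  multiplies a monomial of degree \<open>d\<close> by \<open>2^d\<close>, and coefficients are determined by values.
\<close>
lemma mpoly_homogeneous:
  assumes "\<And>l. mpoly_eval p (\<lambda>i. 2 * l i) = 2 ^ n * mpoly_eval p l"
    and m: "m \<in> Poly_Mapping.keys p" and I: "finite I" "\<forall>m\<in>Poly_Mapping.keys p. Poly_Mapping.keys m \<subseteq> I"
  shows "(\<Sum>i\<in>I. Poly_Mapping.lookup m i) = n"
proof -
  let ?K = "Poly_Mapping.keys p" and ?d = "\<lambda>m. \<Sum>i\<in>I. Poly_Mapping.lookup m i"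
  define q where "q = (\<Sum>k\<in>?K. Poly_Mapping.single k ((2 ^ ?d k - 2 ^ n) * Poly_Mapping.lookup p k))"
  have "monomial_eval (\<lambda>i. 2 * l i) k = 2 ^ ?d k * monomial_eval l k" if "k \<in> ?K" for k and l :: "nat \<Rightarrow> real"
    using I that by (simp add: monomial_eval_superset[of I] power_mult_distrib prod.distrib power_sum)
  then have "mpoly_eval q l = mpoly_eval p (\<lambda>i. 2 * l i) - 2 ^ n * mpoly_eval p l" for l
    by (simp add: q_def mpoly_eval_sum mpoly_eval_single mpoly_eval_superset[of ?K]
        sum_distrib_left algebra_simps flip: sum_subtractf)
  then have "q = 0" using assms(1) by (intro mpoly_eval_0_imp_0) simp
  moreover have "Poly_Mapping.lookup q m = (2 ^ ?d m - 2 ^ n) * Poly_Mapping.lookup p m"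
    using m by (simp add: q_def lookup_sum lookup_single when_def)
  ultimately have "(2::real) ^ ?d m = 2 ^ n" using m by (auto simp: in_keys_iff)
  then show ?thesis by simp
qed

lemma real_polynomial_function_poly:
  assumes "real_polynomial_function (f :: real \<Rightarrow> real)"
  obtains p where "\<And>t. f t = poly p t"
proof -
  obtain a n where "f = (\<lambda>x. \<Sum>i\<le>n. a i * x ^ i)"
    using assms real_polynomial_function_iff_sum by blast
  then show ?thesis
    using that[of "\<Sum>i\<le>n. monom (a i) i"] by (simp add: poly_sum poly_monom)
qed

section \<open>The realification of a quaternionic matrix\<close>

lemma quat_unit_simps [simp]:
  "quat_unit 1 = 1" "quat_unit 2 = Quat 0 1 0 0" "quat_unit 3 = Quat 0 0 1 0"
  "quat_unit 4 = Quat 0 0 0 1"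
  by (simp_all add: quat_unit_def)

lemma qcnj_simps [simp]:
  "qcnj (x + y) = qcnj x + qcnj y" "qcnj (x - y) = qcnj x - qcnj y" "qcnj (- x) = - qcnj x"
  "qcnj (x * y) = qcnj y * qcnj x"
  "qcnj (r *\<^sub>R x) = r *\<^sub>R qcnj x" "qcnj (qcnj x) = x" "qcnj 0 = 0" "qcnj 1 = 1"
  by (simp_all add: quat_eq_iff algebra_simps)

lemma qRe_sum: "qRe (\<Sum>i\<in>S. f i) = (\<Sum>i\<in>S. qRe (f i))"
  by (induction S rule: infinite_finite_induct) auto

lemma realification_nth:
  "realification A $ p $ q =
     qRe (qcnj (quat_unit (snd p)) * A $ fst p $ fst q * quat_unit (snd q))"
proof -
  have "quat_form A (axis i u) (axis j v) = qcnj u * A $ i $ j * v" for i j u v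
  proof -
    have "quat_form A (axis i u) (axis j v) =
       (\<Sum>i'\<in>UNIV. \<Sum>j'\<in>UNIV. if j' = j then (if i' = i then qcnj u * A $ i $ j * v else 0) else 0)"
      unfolding quat_form_def axis_def by (intro sum.cong refl) auto
    then show ?thesis by simp
  qed
  then show ?thesis by (simp add: realification_def)
qed

lemma realification_add: "realification (A + B) = realification A + realification B"
  by (simp add: vec_eq_iff realification_nth algebra_simps)

lemma realification_scaleR: "realification (r *\<^sub>R A) = r *\<^sub>R realification A"
  by (simp add: vec_eq_iff realification_nth algebra_simps)

lemma realification_0: "realification 0 = 0"
  by (simp add: vec_eq_iff realification_nth)

lemma realification_sum: "realification (\<Sum>i\<in>S. f i) = (\<Sum>i\<in>S. realification (f i))"
  by (induction S rule: infinite_finite_induct) (simp_all add: realification_add realification_0)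

lemma realification_mat_1: "realification (mat 1 :: quat^'n^'n) = mat 1"
proof -
  have "qRe (qcnj (quat_unit a) * quat_unit b) = (if a = b then 1 else 0)" for a b
    using exhaust_4[of a] exhaust_4[of b] by auto
  then show ?thesis
    by (auto simp: vec_eq_iff realification_nth mat_def prod_eq_iff)
qed

lemma sum_UNIV_pair: "(\<Sum>p\<in>UNIV. f (p :: 'n::finite \<times> 'm::finite)) = (\<Sum>i\<in>UNIV. \<Sum>a\<in>UNIV. f (i, a))"
  by (simp add: sum.cartesian_product)

text \<open>
  \<open>realification A\<close> is the matrix of the real-linear map \<open>x \<mapsto> A x\<close> in an orthonormal basis, since
  \<open>Re (qcnj u * w)\<close> is the inner product of \<open>u\<close> and \<open>w\<close>.
\<close>
lemma realification_mult: "realification (A ** B) = realification A ** realification B"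
proof -
  have units: "(\<Sum>c\<in>UNIV. qRe (x * quat_unit c) * qRe (qcnj (quat_unit c) * y)) = qRe (x * y)" for x y
    by (simp add: sum_4)
  have "realification (A ** B) $ p $ q = (realification A ** realification B) $ p $ q" for p q
  proof -
    obtain i a j b where pq: "p = (i, a)" "q = (j, b)" by (cases p; cases q) auto
    have "realification (A ** B) $ p $ q =
        (\<Sum>k\<in>UNIV. qRe ((qcnj (quat_unit a) * A $ i $ k) * (B $ k $ j * quat_unit b)))"
      by (simp add: pq realification_nth matrix_matrix_mult_def sum_distrib_left sum_distrib_right
          qRe_sum mult.assoc del: quat_times_sel)
    also have "\<dots> = (\<Sum>k\<in>UNIV. \<Sum>c\<in>UNIV. qRe ((qcnj (quat_unit a) * A $ i $ k) * quat_unit c)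
        * qRe (qcnj (quat_unit c) * (B $ k $ j * quat_unit b)))"
      by (simp only: units)
    also have "\<dots> = (realification A ** realification B) $ p $ q"
      by (simp add: pq realification_nth matrix_matrix_mult_def sum_UNIV_pair mult.assoc
          del: quat_times_sel)
    finally show ?thesis .
  qed
  then show ?thesis by (simp add: vec_eq_iff)
qed

definition cnj_transpose :: "quat^'n^'n \<Rightarrow> quat^'n^'n" where
  "cnj_transpose A = (\<chi> i j. qcnj (A $ j $ i))"

lemma realification_cnj_transpose: "realification (cnj_transpose A) = transpose (realification A)"
proof -
  have "qRe (x * y * z) = qRe (qcnj z * qcnj y * qcnj x)" for x y z
    by (metis mult.assoc qcnj_sel(1) qcnj_simps(4))
  from this[of "qcnj (quat_unit b)" "qcnj z" "quat_unit a" for a b z]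
  have "qRe (qcnj (quat_unit b) * qcnj z * quat_unit a) = qRe (qcnj (quat_unit a) * z * quat_unit b)" for a b z
    by (simp only: qcnj_simps)
  then show ?thesis
    by (simp add: vec_eq_iff realification_nth transpose_def cnj_transpose_def del: quat_times_sel)
qed

lemma hyperhermitian_iff: "hyperhermitian A \<longleftrightarrow> cnj_transpose A = A"
  unfolding hyperhermitian_def cnj_transpose_def vec_eq_iff vec_lambda_beta by metis

lemma realification_eq_0D: "realification A = 0 \<Longrightarrow> A = 0"
proof -
  assume "realification A = 0"
  then have "realification A $ (i, a) $ (j, 1) = 0" for i j a by simp
  then have *: "qRe (qcnj (quat_unit a) * A $ i $ j) = 0" for i j a
    by (simp add: realification_nth)
  show "A = 0"
    using *[of 1] *[of 2] *[of 3] *[of 4] by (simp add: vec_eq_iff quat_eq_iff)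
qed

text \<open>
  The identification of \<open>\<real>\<^sup>4\<^sup>n\<close> with \<open>n\<close>-tuples of quaternions.
\<close>
definition quat_vec :: "real^('n \<times> 4) \<Rightarrow> quat^'n" where
  "quat_vec y = (\<chi> i. \<Sum>a\<in>UNIV. y $ (i, a) *\<^sub>R quat_unit a)"

lemma quat_vec_eq_0_iff: "quat_vec y = 0 \<longleftrightarrow> y = 0"
proof -
  have "quat_vec y = 0 \<longleftrightarrow> (\<forall>i a. y $ (i, a) = 0)"
    by (auto simp: quat_vec_def vec_eq_iff quat_eq_iff sum_4 forall_4)
  then show ?thesis by (auto simp: vec_eq_iff)
qed

lemma inner_realification:
  "y \<bullet> (realification A *v y) = qRe (quat_form A (quat_vec y) (quat_vec y))"
proof -
  have q: "qRe (qcnj (\<Sum>a\<in>UNIV. f a *\<^sub>R quat_unit a) * z * (\<Sum>b\<in>UNIV. g b *\<^sub>R quat_unit b))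
      = (\<Sum>a\<in>UNIV. \<Sum>b\<in>UNIV. f a * (qRe (qcnj (quat_unit a) * z * quat_unit b) * g b))"
    for f g :: "4 \<Rightarrow> real" and z
    by (simp add: sum_4 algebra_simps)
  have "qRe (quat_form A (quat_vec y) (quat_vec y)) =
    (\<Sum>i\<in>UNIV. \<Sum>j\<in>UNIV. \<Sum>a\<in>UNIV. \<Sum>b\<in>UNIV.
       y $ (i, a) * (realification A $ (i, a) $ (j, b) * y $ (j, b)))"
    unfolding quat_form_def quat_vec_def qRe_sum vec_lambda_beta q realification_nth
      fst_conv snd_conv ..
  also have "\<dots> = (\<Sum>i\<in>UNIV. \<Sum>a\<in>UNIV. \<Sum>j\<in>UNIV. \<Sum>b\<in>UNIV.
       y $ (i, a) * (realification A $ (i, a) $ (j, b) * y $ (j, b)))"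
    by (rule sum.cong[OF refl], rule sum.swap)
  also have "\<dots> = y \<bullet> (realification A *v y)"
    by (simp add: inner_vec_def matrix_vector_mult_def sum_distrib_left sum_UNIV_pair)
  finally show ?thesis by simp
qed

lemma positive_definite_realification:
  assumes "positive_definite A" "y \<noteq> 0"
  shows "y \<bullet> (realification A *v y) > 0"
  using assms quat_vec_eq_0_iff[of y]
proof -
  have "qRe (of_real r) = r" for r by (simp add: of_real_def)
  then show ?thesis
    using assms quat_vec_eq_0_iff[of y] unfolding positive_definite_def inner_realification
    by fastforce
qed

lemma quat_form_hyperhermitian:
  assumes "hyperhermitian A"
  shows "quat_form A x x = of_real (qRe (quat_form A x x))"
proof -
  have c: "qcnj (\<Sum>i\<in>S. f i) = (\<Sum>i\<in>S. qcnj (f i))" for S :: "'b set" and f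
    by (induction S rule: infinite_finite_induct) auto
  have A: "qcnj (A $ i $ j) = A $ j $ i" for i j
    using assms by (metis hyperhermitian_def)
  have "qcnj (quat_form A x x) = (\<Sum>i\<in>UNIV. \<Sum>j\<in>UNIV. qcnj (x $ j) * A $ j $ i * x $ i)"
    by (simp add: quat_form_def c A mult.assoc)
  also have "\<dots> = quat_form A x x"
    unfolding quat_form_def by (rule sum.swap)
  finally have "qcnj (quat_form A x x) = quat_form A x x" .
  then show ?thesis by (simp add: quat_eq_iff of_real_def)
qed

lemma quat_vec_surj: "\<exists>y. quat_vec y = x"
  by (rule exI[of _ "\<chi> p. qRe (qcnj (quat_unit (snd p)) * x $ fst p)"])
    (simp add: quat_vec_def vec_eq_iff quat_eq_iff sum_4)

lemma positive_definite_iff: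
  fixes A :: "quat^'n^'n"
  assumes "hyperhermitian A"
  shows "positive_definite A \<longleftrightarrow> (\<forall>y. y \<noteq> 0 \<longrightarrow> y \<bullet> (realification A *v y) > 0)"
proof
  assume R: "\<forall>y. y \<noteq> 0 \<longrightarrow> y \<bullet> (realification A *v y) > 0"
  show "positive_definite A"
    unfolding positive_definite_def
  proof (intro allI impI)
    fix x :: "quat^'n" assume "x \<noteq> 0"
    obtain y where "quat_vec y = x" using quat_vec_surj by blast
    then have "qRe (quat_form A x x) > 0"
      using R \<open>x \<noteq> 0\<close> quat_vec_eq_0_iff[of y] by (auto simp: inner_realification)
    then show "\<exists>r>0. quat_form A x x = of_real r"
      using quat_form_hyperhermitian[OF assms] by blast
  qed
qed (use positive_definite_realification in blast)

lemma transpose_realification: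
  "hyperhermitian A \<Longrightarrow> transpose (realification A) = realification A"
  by (metis hyperhermitian_iff realification_cnj_transpose)

lemma hyperhermitian_add: "hyperhermitian A \<Longrightarrow> hyperhermitian B \<Longrightarrow> hyperhermitian (A + B)"
  unfolding hyperhermitian_def vector_add_component qcnj_simps by metis

lemma hyperhermitian_scaleR: "hyperhermitian A \<Longrightarrow> hyperhermitian (r *\<^sub>R A)"
  unfolding hyperhermitian_def vector_scaleR_component qcnj_simps by metis

lemma hyperhermitian_0: "hyperhermitian 0"
  by (simp add: hyperhermitian_def)

lemma hyperhermitian_mat_1: "hyperhermitian (mat 1)"
  by (auto simp: hyperhermitian_def mat_def)

lemma hyperhermitian_sum: "(\<And>i. i \<in> S \<Longrightarrow> hyperhermitian (f i)) \<Longrightarrow> hyperhermitian (\<Sum>i\<in>S. f i)"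
  by (induction S rule: infinite_finite_induct) (auto simp: hyperhermitian_add hyperhermitian_0)

section \<open>Schur complements of bordered matrices\<close>

text \<open>
  Used to see that the Moore polynomial is affine along rank-one directions.
\<close>
lemma degree_le_1_if_linear_growth:
  fixes p :: "real poly"
  assumes "\<And>t. \<bar>t\<bar> \<ge> 1 \<Longrightarrow> \<bar>poly p t\<bar> \<le> K * \<bar>t\<bar>"
  shows "degree p \<le> 1"
proof (rule ccontr)
  assume d: "\<not> degree p \<le> 1"
  obtain a q where p: "p = pCons a q" by (cases p)
  with d have "degree q > 0" by (auto split: if_splits)
  then have "filterlim (poly q) at_infinity at_infinity"
    by (rule filterlim_poly_at_infinity)
  moreover have "\<bar>K\<bar> + \<bar>a\<bar> + 1 > 0" by linarith
  ultimately have "\<forall>\<^sub>F t in at_infinity. \<bar>K\<bar> + \<bar>a\<bar> + 1 \<le> norm (poly q t)"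
    using filterlim_at_infinity[of 0] by blast
  moreover have "\<forall>\<^sub>F t in at_infinity. 1 \<le> norm (t :: real)"
    unfolding eventually_at_infinity by blast
  ultimately have "\<forall>\<^sub>F t in at_infinity. \<bar>K\<bar> + \<bar>a\<bar> + 1 \<le> norm (poly q t) \<and> 1 \<le> norm t"
    by (rule eventually_conj)
  then obtain t where t: "\<bar>t\<bar> \<ge> 1" "\<bar>poly q t\<bar> \<ge> \<bar>K\<bar> + \<bar>a\<bar> + 1"
    using eventually_happens'[OF trivial_limit_at_infinity] unfolding real_norm_def by blast
  have "(\<bar>K\<bar> + \<bar>a\<bar> + 1) * \<bar>t\<bar> \<le> \<bar>poly q t\<bar> * \<bar>t\<bar>"
    using t by (intro mult_right_mono) auto
  also have "\<dots> = \<bar>poly p t - a\<bar>" by (simp add: p abs_mult)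
  also have "\<dots> \<le> K * \<bar>t\<bar> + \<bar>a\<bar> * \<bar>t\<bar>"
    using assms[OF t(1)] mult_left_mono[OF t(1), of "\<bar>a\<bar>"] by linarith
  also have "\<dots> \<le> (\<bar>K\<bar> + \<bar>a\<bar>) * \<bar>t\<bar>"
    using mult_right_mono[of K "\<bar>K\<bar>" "\<bar>t\<bar>"] by (simp add: distrib_right)
  finally show False using t by (simp add: distrib_right)
qed

lemma bounded_linear_quat_sel: "bounded_linear qRe" "bounded_linear qI" "bounded_linear qJ" "bounded_linear qK"
proof -
  have bound: "\<bar>r\<bar> \<le> norm x" if "r\<^sup>2 \<le> inner x x" for r and x :: quat
    using that real_sqrt_le_mono[OF that] by (simp add: norm_quat_def)
  have b: "\<bar>qRe x\<bar> \<le> norm x" "\<bar>qI x\<bar> \<le> norm x" "\<bar>qJ x\<bar> \<le> norm x" "\<bar>qK x\<bar> \<le> norm x" for x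
    by (rule bound, simp add: inner_quat_def power2_eq_square)+
  show "bounded_linear qRe" "bounded_linear qI" "bounded_linear qJ" "bounded_linear qK"
    by (rule bounded_linear_intro[where K = 1], simp, simp, simp add: b)+
qed

lemma bounded_linear_quat_matrix_entry:
  "bounded_linear f \<Longrightarrow> bounded_linear (\<lambda>A :: quat^'n^'m. f (A $ i $ j))"
  by (rule bounded_linear_compose[OF _ bounded_linear_compose[OF bounded_linear_vec_nth bounded_linear_vec_nth]])

lemmas real_polynomial_function_quat_entry =
  bounded_linear_quat_sel[THEN bounded_linear_quat_matrix_entry, THEN real_polynomial_function.intros(1)]

text \<open>
  Over the real basis formed by the four units at each position, the matrix is a sum of polynomial
  multiples of constant matrices.
\<close>
lemma polynomial_function_quat_matrixI:
  fixes F :: "'v::real_normed_vector \<Rightarrow> quat^'n^'m"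
  assumes "\<And>j k. real_polynomial_function (\<lambda>x. qRe (F x $ j $ k))"
    "\<And>j k. real_polynomial_function (\<lambda>x. qI (F x $ j $ k))"
    "\<And>j k. real_polynomial_function (\<lambda>x. qJ (F x $ j $ k))"
    "\<And>j k. real_polynomial_function (\<lambda>x. qK (F x $ j $ k))"
  shows "polynomial_function F"
proof -
  define E where "E = (\<lambda>j k u. axis j (axis k u) :: quat^'n^'m)"
  have entry: "(\<Sum>j\<in>UNIV. \<Sum>k\<in>UNIV. r j k *\<^sub>R E j k u) $ j' $ k' = r j' k' *\<^sub>R u" for r u j' k'
  proof -
    have "(\<Sum>j\<in>UNIV. \<Sum>k\<in>UNIV. r j k *\<^sub>R E j k u) $ j' $ k' =
      (\<Sum>j\<in>UNIV. \<Sum>k\<in>UNIV. if k' = k then (if j' = j then r j k *\<^sub>R u else 0) else 0)"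
      unfolding sum_component by (intro sum.cong refl) (simp add: E_def axis_def)
    then show ?thesis by simp
  qed
  have "polynomial_function (\<lambda>x. (\<Sum>j\<in>UNIV. \<Sum>k\<in>UNIV. qRe (F x $ j $ k) *\<^sub>R E j k (Quat 1 0 0 0))
     + (\<Sum>j\<in>UNIV. \<Sum>k\<in>UNIV. qI (F x $ j $ k) *\<^sub>R E j k (Quat 0 1 0 0))
     + (\<Sum>j\<in>UNIV. \<Sum>k\<in>UNIV. qJ (F x $ j $ k) *\<^sub>R E j k (Quat 0 0 1 0))
     + (\<Sum>j\<in>UNIV. \<Sum>k\<in>UNIV. qK (F x $ j $ k) *\<^sub>R E j k (Quat 0 0 0 1)))"
    (is "polynomial_function ?G")
    by (intro polynomial_function_add polynomial_function_sum polynomial_function_mult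
        polynomial_function_const finite assms[unfolded real_polynomial_function_eq])
  moreover have "?G = F"
    by (intro ext) (simp only: vec_eq_iff vector_add_component entry, simp add: quat_eq_iff)
  ultimately show ?thesis by simp
qed

definition outer :: "quat^'n \<Rightarrow> quat^'n^'n" where
  "outer v = (\<chi> i j. v $ i * qcnj (v $ j))"

definition quat_diag :: "'n \<Rightarrow> real \<Rightarrow> quat^'n^'n" where
  "quat_diag i a = (\<chi> j k. if j = k then (if j = i then of_real a else 1) else 0)"

definition bordered :: "'n \<Rightarrow> quat^'n^'n \<Rightarrow> quat^'n \<Rightarrow> real \<Rightarrow> quat^'n^'n" where
  "bordered i B v a = (\<chi> j k.
     if j = i then (if k = i then of_real a else qcnj (v $ k)) else if k = i then v $ j else B $ j $ k)"

lemma qRe_of_real [simp]: "qRe (of_real r) = r" "qI (of_real r) = 0" "qJ (of_real r) = 0" "qK (of_real r) = 0"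
  by (simp_all add: of_real_def)

lemma det_realification_quat_diag: "det (realification (quat_diag (i :: 'n::finite) a)) = a ^ 4"
proof -
  have "qRe (qcnj (quat_unit c) * of_real r * quat_unit d) = (if c = d then r else 0)" for c d r
    using exhaust_4[of c] exhaust_4[of d] by auto
  note units = this this[of _ 1, unfolded of_real_1 mult_1_right]
  have R: "realification (quat_diag i a) $ p $ q = (if p = q then (if fst p = i then a else 1) else 0)" for p q
    by (auto simp: realification_nth quat_diag_def units prod_eq_iff simp del: quat_times_sel)
  have "det (realification (quat_diag i a)) = (\<Prod>p\<in>(UNIV :: ('n \<times> 4) set). if fst p = i then a else 1)"
    by (subst det_diagonal) (auto simp: R)
  also have "\<dots> = (\<Prod>j\<in>UNIV. \<Prod>c\<in>(UNIV :: 4 set). if j = i then a else 1)"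
    by (simp only: prod.cartesian_product UNIV_Times_UNIV case_prod_unfold)
  also have "\<dots> = (\<Prod>j\<in>UNIV. if j = i then a ^ 4 else 1)"
    by (intro prod.cong) auto
  finally show ?thesis by simp
qed

lemma quat_diag_mult: "(quat_diag i a ** X) $ j $ k = (if j = i then a *\<^sub>R X $ j $ k else X $ j $ k)"
proof -
  have "(quat_diag i a ** X) $ j $ k =
      (\<Sum>l\<in>UNIV. if l = j then (if j = i then a *\<^sub>R X $ j $ k else X $ j $ k) else 0)"
    unfolding matrix_matrix_mult_def quat_diag_def vec_lambda_beta
    by (intro sum.cong refl) (auto simp: of_real_def)
  then show ?thesis by simp
qed

lemma mult_quat_diag: "(X ** quat_diag i a) $ j $ k = (if k = i then a *\<^sub>R X $ j $ k else X $ j $ k)"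
proof -
  have "(X ** quat_diag i a) $ j $ k =
      (\<Sum>l\<in>UNIV. if l = k then (if k = i then a *\<^sub>R X $ j $ k else X $ j $ k) else 0)"
    unfolding matrix_matrix_mult_def quat_diag_def vec_lambda_beta
    by (intro sum.cong refl) (auto simp: of_real_def)
  then show ?thesis by simp
qed

text \<open>
  The identity plus a column \<open>v\<close> at position \<open>i\<close>: the unitriangular factor in the Schur
  decomposition.  The index type carries no order, so it is not triangular in any literal sense.
\<close>
definition shear :: "'n \<Rightarrow> quat^'n \<Rightarrow> quat^'n^'n" where
  "shear i v = (\<chi> j k. (if j = k then 1 else 0) + (if k = i then v $ j else 0))"

lemma shear_mult: "(shear i v ** X) $ j $ k = X $ j $ k + v $ j * X $ i $ k"
proof -
  have "(shear i v ** X) $ j $ k =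
      (\<Sum>l\<in>UNIV. (if l = j then X $ j $ k else 0) + (if l = i then v $ j * X $ i $ k else 0))"
    unfolding matrix_matrix_mult_def shear_def vec_lambda_beta
    by (intro sum.cong refl) (auto simp: distrib_right)
  then show ?thesis by (simp add: sum.distrib)
qed

lemma mult_cnj_transpose_shear:
  "(X ** cnj_transpose (shear i v)) $ j $ k = X $ j $ k + X $ j $ i * qcnj (v $ k)"
proof -
  have "(X ** cnj_transpose (shear i v)) $ j $ k =
      (\<Sum>l\<in>UNIV. (if l = k then X $ j $ k else 0) + (if l = i then X $ j $ i * qcnj (v $ k) else 0))"
    unfolding matrix_matrix_mult_def shear_def cnj_transpose_def vec_lambda_beta
    by (intro sum.cong refl) (auto simp: distrib_left)
  then show ?thesis by (simp add: sum.distrib)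
qed

text \<open>
  The inverse of the shear by \<open>v\<close> is the shear by \<open>- v\<close>, and both are conjugate under the reflection
  in coordinate \<open>i\<close>, whose realification has determinant \<open>(-1)^4\<close>.  So their determinants are equal
  and multiply to 1.
\<close>
lemma det_realification_shear:
  assumes "v $ i = 0"
  shows "(det (realification (shear i v)))\<^sup>2 = 1"
proof -
  let ?R = "\<lambda>A :: quat^'n^'n. det (realification A)"
  have "shear i v ** shear i (- v) = mat 1"
    using assms by (simp add: vec_eq_iff shear_mult) (simp add: shear_def mat_def)
  then have inv: "?R (shear i v) * ?R (shear i (- v)) = 1"
    by (metis det_I det_mul realification_mat_1 realification_mult)
  have "quat_diag i (-1) ** (shear i v ** quat_diag i (-1)) = shear i (- v)"
    using assms by (auto simp: vec_eq_iff quat_diag_mult mult_quat_diag shear_def)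
  then have "?R (shear i (- v)) = (-1) ^ 4 * (?R (shear i v) * (-1) ^ 4)"
    by (metis det_mul det_realification_quat_diag realification_mult)
  then show ?thesis
    using inv by (simp add: power2_eq_square)
qed

text \<open>
  The Schur complement: clearing row and column \<open>i\<close> by a shear and its adjoint leaves
  \<open>B - v v* / a\<close> with \<open>a\<close> at position \<open>i\<close>.  The exponent is 4 because one quaternionic coordinate is
  four real ones.
\<close>
lemma det_realification_bordered:
  assumes v: "v $ i = 0" and B: "\<And>j. B $ i $ j = (if j = i then 1 else 0)"
    "\<And>j. B $ j $ i = (if j = i then 1 else 0)" and a: "a \<noteq> 0"
  shows "det (realification (bordered i B v a))
    = a ^ 4 * det (realification (B - (1 / a) *\<^sub>R outer v))"
proof -
  let ?M = "B - (1 / a) *\<^sub>R outer v"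
  define N where "N = ?M ** quat_diag i a"
  let ?L = "shear i ((1 / a) *\<^sub>R v)"
  have N: "N $ j $ k = (if k = i then (if j = i then a *\<^sub>R 1 else 0)
      else if j = i then 0 else B $ j $ k - (1 / a) *\<^sub>R (v $ j * qcnj (v $ k)))" for j k
    using v B by (auto simp: N_def mult_quat_diag outer_def)
  have "?L ** N ** cnj_transpose ?L = bordered i B v a"
    using a v by (simp add: vec_eq_iff mult_cnj_transpose_shear shear_mult N bordered_def of_real_def)
  then have "det (realification (bordered i B v a)) = det (realification (?L ** N ** cnj_transpose ?L))"
    by (rule arg_cong[OF sym])
  also have "\<dots> = (det (realification ?L))\<^sup>2 * det (realification N)"
    by (simp only: realification_mult det_mul realification_cnj_transpose det_transpose
        power2_eq_square mult_ac)
  also have "\<dots> = det (realification N)"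
    using det_realification_shear[of "(1 / a) *\<^sub>R v" i] v by simp
  finally show ?thesis
    by (simp add: N_def realification_mult det_mul det_realification_quat_diag)
qed

section \<open>Existence and uniqueness of the Moore polynomial\<close>

lemma hyperhermitian_outer: "hyperhermitian (outer v)"
  by (simp add: hyperhermitian_def outer_def)

lemma continuous_det_realification_line:
  "continuous_on UNIV (\<lambda>t. det (realification (A + t *\<^sub>R B)))"
  unfolding realification_add realification_scaleR det_def
  by (intro continuous_intros)

lemma polynomial_function_line: "polynomial_function (\<lambda>t. A + t *\<^sub>R B)"
  by (intro polynomial_function_add polynomial_function_mult polynomial_function_const) simp

lemma poly_on_line:
  assumes "real_polynomial_function P"
  obtains p where "\<And>t. P (A + t *\<^sub>R B) = poly p t"
proof -
  have "real_polynomial_function (P \<circ> (\<lambda>t. A + t *\<^sub>R B))"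
    using assms polynomial_function_line by (rule real_polynomial_function_compose[rotated])
  from real_polynomial_function_poly[OF this] obtain p
    where "\<And>t. (P \<circ> (\<lambda>t. A + t *\<^sub>R B)) t = poly p t" by blast
  then show ?thesis by (intro that[of p]) simp
qed

text \<open>
  Along the direction \<open>v v*\<close> the function \<open>P\<close> is affine.  Indeed the Schur complement says that
  \<open>(a P(B - v v* / a))^4\<close> is the determinant of the bordered matrix, which stays bounded as \<open>a\<close> tends
  to 0, so \<open>P(B + t v v*)\<close> grows at most linearly in \<open>t\<close>.  For an affine function the bracket is the
  polynomial on the right-hand side, and continuity covers the value \<open>a = 0\<close>.
\<close>
lemma det_realification_bordered_fourth_power:
  fixes B :: "quat^'n^'n"
  assumes v: "v $ i = 0" and B: "\<And>j. B $ i $ j = (if j = i then 1 else 0)"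
    "\<And>j. B $ j $ i = (if j = i then 1 else 0)"
    and P: "real_polynomial_function P"
    "\<And>t. det (realification (B + t *\<^sub>R outer v)) = P (B + t *\<^sub>R outer v) ^ 4"
  shows "det (realification (bordered i B v a)) = ((a + 1) * P B - P (B + outer v)) ^ 4"
proof -
  define G where "G = (\<lambda>a. det (realification (bordered i B v a)))"
  obtain p where p: "\<And>t. P (B + t *\<^sub>R outer v) = poly p t"
    by (rule poly_on_line[OF P(1), of B "outer v"]) (rule that)
  define E :: "quat^'n^'n" where "E = (\<chi> j k. if j = i \<and> k = i then 1 else 0)"
  have E: "bordered i B v 0 + a *\<^sub>R E = bordered i B v a" for a
    by (simp add: vec_eq_iff bordered_def E_def of_real_def)
  have cont: "continuous_on UNIV G"
    using continuous_det_realification_line[of "bordered i B v 0" E] unfolding G_def E .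
  have schur: "G a = (a * poly p (- 1 / a)) ^ 4" if "a \<noteq> 0" for a
    using det_realification_bordered[OF v B that] P(2)[of "- 1 / a"] p[of "- 1 / a"]
    by (simp add: G_def power_mult_distrib)
  have "compact (G ` {-1..1})"
    by (rule compact_continuous_image[OF continuous_on_subset[OF cont]]) auto
  then obtain C where C: "\<And>a. a \<in> {-1..1} \<Longrightarrow> \<bar>G a\<bar> \<le> C"
    using compact_imp_bounded bounded_real by (metis imageI)
  \<comment> \<open>Substituting \<open>a = - 1 / t\<close> turns boundedness near 0 into linear growth at infinity.\<close>
  have "\<bar>poly p t\<bar> \<le> (1 + C) * \<bar>t\<bar>" if t: "\<bar>t\<bar> \<ge> 1" for t
  proof -
    have "\<bar>- 1 / t\<bar> \<le> 1" using t by (simp add: abs_divide)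
    then have "- 1 / t \<in> {-1..1}" unfolding atLeastAtMost_iff by linarith
    from C[OF this] schur[of "- 1 / t"] t have le: "\<bar>poly p t / t\<bar> ^ 4 \<le> C"
      by (auto simp: abs_mult power_abs)
    have "\<bar>poly p t / t\<bar> \<le> 1 + C"
    proof (cases "\<bar>poly p t / t\<bar> \<le> 1")
      case True
      moreover have "0 \<le> C" using le by (meson order_trans zero_le_power abs_ge_zero)
      ultimately show ?thesis by linarith
    next
      case False
      then have "\<bar>poly p t / t\<bar> ^ 1 \<le> \<bar>poly p t / t\<bar> ^ 4"
        by (intro power_increasing) auto
      with le show ?thesis by simp
    qed
    then show ?thesis using t by (simp add: abs_divide pos_divide_le_eq)
  qed
  then have deg: "degree p \<le> 1" by (rule degree_le_1_if_linear_growth)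
  have affine: "poly p t = coeff p 0 + t * coeff p 1" for t
  proof -
    have "poly p t = (\<Sum>i\<le>1. coeff p i * t ^ i)"
      unfolding poly_altdef using deg
      by (intro sum.mono_neutral_left) (auto simp: coeff_eq_0)
    then show ?thesis by (simp add: mult.commute)
  qed
  let ?H = "\<lambda>a. ((a + 1) * P B - P (B + outer v)) ^ 4"
  have PB: "P B = coeff p 0" "P (B + outer v) = coeff p 0 + coeff p 1"
    using p[of 0] p[of 1] by (simp_all add: affine)
  have eq: "G a = ?H a" if "a \<noteq> 0" for a
    using that by (simp add: schur PB affine algebra_simps)
  have "(G \<longlongrightarrow> G 0) (at 0)"
    using cont by (simp add: continuous_on_eq_continuous_at isCont_def)
  moreover have "(G \<longlongrightarrow> ?H 0) (at 0)"
  proof (rule Lim_transform_eventually)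
    show "(?H \<longlongrightarrow> ?H 0) (at 0)" by (intro tendsto_intros)
    show "\<forall>\<^sub>F a in at 0. ?H a = G a"
      using eq by (auto simp: eventually_at_filter)
  qed
  ultimately have "G 0 = ?H 0" by (rule tendsto_unique[OF at_neq_bot])
  with eq show ?thesis by (cases "a = 0") (auto simp: G_def)
qed

text \<open>
  The principal block on \<open>S\<close>, padded with the identity so that all blocks have the same type and the
  induction can run over subsets of the index type.
\<close>
definition principal_block :: "'n set \<Rightarrow> quat^'n^'n \<Rightarrow> quat^'n^'n" where
  "principal_block S A = (\<chi> i j. if i \<in> S \<and> j \<in> S then A $ i $ j else if i = j then 1 else 0)"

lemma real_polynomial_function_quat_mult_sel:
  assumes "\<And>f. f \<in> {qRe, qI, qJ, qK} \<Longrightarrow> real_polynomial_function (\<lambda>x. f (F x))"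
    "\<And>f. f \<in> {qRe, qI, qJ, qK} \<Longrightarrow> real_polynomial_function (\<lambda>x. f (G x))"
    and "f \<in> {qRe, qI, qJ, qK}"
  shows "real_polynomial_function (\<lambda>x. f (F x * qcnj (G x)))"
proof -
  have FG: "real_polynomial_function (\<lambda>x. g (F x))" "real_polynomial_function (\<lambda>x. g (G x))"
    if "g \<in> {qRe, qI, qJ, qK}" for g
    using assms(1,2) that by blast+
  have "real_polynomial_function (\<lambda>x. qRe (F x * qcnj (G x)))"
    "real_polynomial_function (\<lambda>x. qI (F x * qcnj (G x)))"
    "real_polynomial_function (\<lambda>x. qJ (F x * qcnj (G x)))"
    "real_polynomial_function (\<lambda>x. qK (F x * qcnj (G x)))"
    unfolding quat_times_sel qcnj_sel
    by (intro real_polynomial_function_diff real_polynomial_function_minus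
        real_polynomial_function.intros(3,4) FG; simp)+
  then show ?thesis using assms(3) by auto
qed

text \<open>
  The induction adds one index at a time.  The new polynomial is
  \<open>(a + 1) P(B) - P(B + v v*)\<close>, with \<open>a\<close> the new diagonal entry and \<open>v\<close> the new column: a polynomial
  expression that stands for the rational one \<open>a P(B - v v* / a)\<close>.
\<close>
lemma moore_polynomial_principal_block:
  fixes S :: "'n::finite set"
  assumes "finite S"
  shows "\<exists>P :: quat^'n^'n \<Rightarrow> real. real_polynomial_function P \<and>
     (\<forall>A. hyperhermitian A \<longrightarrow> det (realification (principal_block S A)) = P A ^ 4) \<and> P (mat 1) = 1"
  using assms
proof (induction S)
  case empty
  have "principal_block {} A = mat 1" for A :: "quat^'n^'n"
    by (simp add: principal_block_def mat_def)
  then show ?case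
    by (intro exI[of _ "\<lambda>_. 1"]) (auto simp: realification_mat_1 intro: real_polynomial_function.intros)
next
  case (insert i S)
  then obtain P :: "quat^'n^'n \<Rightarrow> real" where P: "real_polynomial_function P"
    "\<And>A. hyperhermitian A \<Longrightarrow> det (realification (principal_block S A)) = P A ^ 4"
    "P (mat 1) = 1" by blast
  define v :: "quat^'n^'n \<Rightarrow> quat^'n" where "v = (\<lambda>A. \<chi> j. if j \<in> S then A $ j $ i else 0)"
  define B where "B = (\<lambda>A. principal_block S A :: quat^'n^'n)"
  define Q where "Q = (\<lambda>A. (qRe (A $ i $ i) + 1) * P (B A) - P (B A + outer (v A)))"
  have pick: "real_polynomial_function (\<lambda>A. f (if b then A $ j $ k else c))"
    if "f \<in> {qRe, qI, qJ, qK}" for f b and c :: quat and j k :: 'n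
    using that by (cases b) (auto intro: real_polynomial_function_quat_entry real_polynomial_function.intros(2))
  have polyB: "real_polynomial_function (\<lambda>A. f (B A $ j $ k))" if "f \<in> {qRe, qI, qJ, qK}" for f j k
    using pick[OF that, of "j \<in> S \<and> k \<in> S" j k] by (simp add: B_def principal_block_def)
  have polyv: "real_polynomial_function (\<lambda>A. f (outer (v A) $ j $ k))" if "f \<in> {qRe, qI, qJ, qK}" for f j k
    unfolding outer_def v_def vec_lambda_beta
    using that by (intro real_polynomial_function_quat_mult_sel pick)
  have B_poly: "polynomial_function B"
    by (intro polynomial_function_quat_matrixI polyB) auto
  have "polynomial_function (\<lambda>A. outer (v A))"
    by (intro polynomial_function_quat_matrixI polyv) auto
  with B_poly have "polynomial_function (\<lambda>A. B A + outer (v A))"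
    by (rule polynomial_function_add)
  from real_polynomial_function_compose[OF B_poly P(1)] real_polynomial_function_compose[OF this P(1)]
  have "real_polynomial_function (P \<circ> B)"
    "real_polynomial_function (P \<circ> (\<lambda>A. B A + outer (v A)))"
    by blast+
  then have "real_polynomial_function Q"
    unfolding Q_def comp_def
    by (intro real_polynomial_function_diff real_polynomial_function.intros(2-4)
        real_polynomial_function_quat_entry(1))
  moreover have "det (realification (principal_block (insert i S) A)) = Q A ^ 4"
    if A: "hyperhermitian A" for A
  proof -
    have cnj: "qcnj (A $ j $ k) = A $ k $ j" for j k
      using A by (metis hyperhermitian_def)
    have "qI (A $ i $ i) = 0" "qJ (A $ i $ i) = 0" "qK (A $ i $ i) = 0"
      using cnj[of i i] by (auto simp: quat_eq_iff)
    then have "A $ i $ i = of_real (qRe (A $ i $ i))"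
      by (simp add: quat_eq_iff)
    then have border: "principal_block (insert i S) A = bordered i (B A) (v A) (qRe (A $ i $ i))"
      using insert.hyps by (auto simp: vec_eq_iff bordered_def B_def v_def principal_block_def cnj)
    have "hyperhermitian (B A)"
      using cnj by (auto simp: B_def principal_block_def hyperhermitian_def)
    moreover have "principal_block S (B A + t *\<^sub>R outer (v A)) = B A + t *\<^sub>R outer (v A)" for t
      by (auto simp: vec_eq_iff principal_block_def outer_def B_def v_def)
    ultimately have "det (realification (B A + t *\<^sub>R outer (v A))) = P (B A + t *\<^sub>R outer (v A)) ^ 4" for t
      using P(2)[of "B A + t *\<^sub>R outer (v A)"]
      by (simp add: hyperhermitian_add hyperhermitian_scaleR hyperhermitian_outer)
    then show ?thesis
      unfolding border Q_def using insert.hyps P(1)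
      by (intro det_realification_bordered_fourth_power) (auto simp: v_def B_def principal_block_def)
  qed
  moreover have "Q (mat 1) = 1"
  proof -
    have "v (mat 1) = 0" using insert.hyps by (auto simp: v_def mat_def vec_eq_iff)
    moreover have "outer 0 = (0 :: quat^'n^'n)" by (simp add: outer_def vec_eq_iff)
    moreover have "B (mat 1) = mat 1" by (auto simp: B_def principal_block_def mat_def vec_eq_iff)
    ultimately show ?thesis using P(3) by (simp add: Q_def mat_def)
  qed
  ultimately show ?case by blast
qed

lemma ex_moore_polynomial: "\<exists>P :: quat^'n::finite^'n \<Rightarrow> real. moore_polynomial P"
proof -
  have "principal_block UNIV A = A" for A :: "quat^'n^'n"
    by (simp add: principal_block_def vec_eq_iff)
  then show ?thesis
    using moore_polynomial_principal_block[of "UNIV :: 'n set"] by (auto simp: moore_polynomial_def)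
qed

text \<open>
  On the line through the identity and \<open>A\<close> both are univariate real polynomials \<open>p\<close>, \<open>q\<close> with
  \<open>p^4 = q^4\<close>, that is, \<open>(p - q) (p + q) (p\<^sup>2 + q\<^sup>2) = 0\<close>.  The last two factors are nonzero at the
  identity, where \<open>p\<close> and \<open>q\<close> are both 1.
\<close>
lemma moore_polynomial_unique:
  assumes P: "moore_polynomial P" and Q: "moore_polynomial Q" and A: "hyperhermitian A"
  shows "P A = Q A"
proof -
  let ?l = "\<lambda>t. mat 1 + t *\<^sub>R (A - mat 1)"
  have poly: "real_polynomial_function P" "real_polynomial_function Q"
    using P Q by (auto simp: moore_polynomial_def)
  obtain p where p: "\<And>t. P (?l t) = poly p t" by (rule poly_on_line[OF poly(1), of "mat 1" "A - mat 1"]) (rule that)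
  obtain q where q: "\<And>t. Q (?l t) = poly q t" by (rule poly_on_line[OF poly(2), of "mat 1" "A - mat 1"]) (rule that)
  have "hyperhermitian (?l t)" for t
    using A hyperhermitian_mat_1 hyperhermitian_add[OF A hyperhermitian_scaleR[of "mat 1" "-1"]]
    by (intro hyperhermitian_add hyperhermitian_scaleR) auto
  then have pq: "poly p t ^ 4 = poly q t ^ 4" for t
    using P Q unfolding moore_polynomial_def by (simp flip: p q)
  have factor: "x ^ 4 - y ^ 4 = (x - y) * (x + y) * (x\<^sup>2 + y\<^sup>2)" for x y :: real
    by (simp add: algebra_simps power2_eq_square power4_eq_xxxx)
  have "poly ((p - q) * (p + q) * (p\<^sup>2 + q\<^sup>2)) t = 0" for t
    using pq[of t] factor[of "poly p t" "poly q t"]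
    by (simp only: poly_add poly_diff poly_mult poly_power)
  then have "(p - q) * (p + q) * (p\<^sup>2 + q\<^sup>2) = 0"
    using poly_all_0_iff_0 by blast
  moreover have "poly p 0 = 1" "poly q 0 = 1"
    using P Q p[of 0] q[of 0] by (auto simp: moore_polynomial_def)
  then have "poly (p + q) 0 \<noteq> 0" "poly (p\<^sup>2 + q\<^sup>2) 0 \<noteq> 0" by auto
  then have "p + q \<noteq> 0" "p\<^sup>2 + q\<^sup>2 \<noteq> 0" by force+
  ultimately have "p = q" by auto
  then show ?thesis using p[of 1] q[of 1] by simp
qed

lemma moore_det_eq:
  assumes "moore_polynomial P" "hyperhermitian A"
  shows "moore_det A = P A"
  unfolding moore_det_def using assms moore_polynomial_unique by (intro the_equality) blast+

text \<open>
  Up to normalization \<open>B \<mapsto> P (2 B)\<close> is again a Moore polynomial, so uniqueness gives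
  \<open>P (2 A) = P (2) P (A)\<close>.  The fourth power of \<open>P (2)\<close> is known, and its sign is positive because
  \<open>P\<close> has no zero on the segment from the identity to its double.
\<close>
lemma moore_polynomial_double:
  fixes P :: "quat^'n^'n \<Rightarrow> real"
  assumes P: "moore_polynomial P" and A: "hyperhermitian A"
  shows "P (2 *\<^sub>R A) = 2 ^ CARD('n) * P A"
proof -
  let ?I = "mat 1 :: quat^'n^'n"
  have det_scale: "det (realification (r *\<^sub>R B)) = (r ^ CARD('n)) ^ 4 * det (realification B)"
    for r and B :: "quat^'n^'n"
  proof -
    have "r *\<^sub>R M = mat r ** M" for M :: "real^('n \<times> 4)^('n \<times> 4)"
      by (simp add: vec_eq_iff matrix_matrix_mult_def mat_def if_distrib[of "\<lambda>x. x * _"] cong: if_cong)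
    moreover have "det (mat r :: real^('n \<times> 4)^('n \<times> 4)) = r ^ (CARD('n) * 4)"
      by (subst det_diagonal) (auto simp: mat_def)
    ultimately show ?thesis
      by (simp add: realification_scaleR det_mul power_mult)
  qed
  have P4: "P (r *\<^sub>R B) ^ 4 = (r ^ CARD('n)) ^ 4 * P B ^ 4" if "hyperhermitian B" for r B
    using P that det_scale[of r B] hyperhermitian_scaleR[OF that] unfolding moore_polynomial_def by simp
  have PI: "P (r *\<^sub>R ?I) ^ 4 = (r ^ CARD('n)) ^ 4" for r
    using P4[OF hyperhermitian_mat_1, of r] P by (simp add: moore_polynomial_def)
  have pos: "P (2 *\<^sub>R ?I) > 0"
  proof (rule ccontr)
    assume neg: "\<not> P (2 *\<^sub>R ?I) > 0"
    have poly: "real_polynomial_function P" using P by (simp add: moore_polynomial_def)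
    obtain p where p: "\<And>t. P (0 + t *\<^sub>R ?I) = poly p t"
      by (rule poly_on_line[OF poly, of 0 ?I]) (rule that)
    have "poly p 1 = 1" "poly p 2 \<le> 0"
      using p[of 1] p[of 2] P neg by (auto simp: moore_polynomial_def)
    moreover have "continuous_on {1..2} (poly p)"
      by (intro continuous_on_poly continuous_on_id)
    ultimately obtain t where "1 \<le> t" "t \<le> 2" "poly p t = 0"
      using IVT2'[of "poly p" 2 0 1] by (metis one_le_numeral zero_le_one)
    then show False using PI[of t] p[of t] by simp
  qed
  have "P (2 *\<^sub>R ?I) = 2 ^ CARD('n)"
    by (rule power_eq_imp_eq_base[OF PI[of 2]]) (use pos in simp_all)
  moreover have "moore_polynomial (\<lambda>B. P (2 *\<^sub>R B) / P (2 *\<^sub>R ?I))"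
    unfolding moore_polynomial_def
  proof (intro conjI allI impI)
    have "polynomial_function (\<lambda>B :: quat^'n^'n. 2 *\<^sub>R B)" by auto
    then show "real_polynomial_function (\<lambda>B. P (2 *\<^sub>R B) / P (2 *\<^sub>R ?I))"
      using real_polynomial_function_compose[of "\<lambda>B. 2 *\<^sub>R B" P] P
      by (auto simp: moore_polynomial_def comp_def)
    show "det (realification B) = (P (2 *\<^sub>R B) / P (2 *\<^sub>R ?I)) ^ 4" if "hyperhermitian B" for B
      using P4[OF that, of 2] PI[of 2] P that by (simp add: power_divide moore_polynomial_def)
    show "P (2 *\<^sub>R mat 1) / P (2 *\<^sub>R ?I) = 1" using pos by simp
  qed
  then have "P (2 *\<^sub>R A) / P (2 *\<^sub>R ?I) = P A"
    using moore_polynomial_unique[OF _ P A] by blast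
  ultimately show ?thesis using pos by (simp add: field_simps)
qed

section \<open>Mixed discriminants as alternating sums\<close>

lemma moore_det_mpoly:
  fixes B :: "nat \<Rightarrow> quat^'n^'n"
  assumes "finite I" "\<forall>i\<in>I. hyperhermitian (B i)"
  obtains p where
    "\<forall>m\<in>Poly_Mapping.keys p. Poly_Mapping.keys m \<subseteq> I"
    "\<forall>m\<in>Poly_Mapping.keys p. (\<Sum>i\<in>I. Poly_Mapping.lookup m i) = CARD('n)"
    "\<forall>l. mpoly_eval p l = moore_det (\<Sum>i\<in>I. l i *\<^sub>R B i)"
proof -
  obtain P :: "quat^'n^'n \<Rightarrow> real" where P: "moore_polynomial P"
    using ex_moore_polynomial by blast
  then have "real_polynomial_function P" by (simp add: moore_polynomial_def)
  from mpoly_linear_substitution[OF this assms(1), of B] obtain p where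
    p: "\<forall>m\<in>Poly_Mapping.keys p. Poly_Mapping.keys m \<subseteq> I"
      "\<forall>l. mpoly_eval p l = P (\<Sum>i\<in>I. l i *\<^sub>R B i)" by blast
  have hyp: "hyperhermitian (\<Sum>i\<in>I. l i *\<^sub>R B i)" for l
    by (intro hyperhermitian_sum hyperhermitian_scaleR assms(2)[rule_format])
  show ?thesis
  proof (rule that[of p])
    show "\<forall>l. mpoly_eval p l = moore_det (\<Sum>i\<in>I. l i *\<^sub>R B i)"
      using p(2) moore_det_eq[OF P hyp] by simp
    have "mpoly_eval p (\<lambda>i. 2 * l i) = 2 ^ CARD('n) * mpoly_eval p l" for l
      using p(2) moore_polynomial_double[OF P hyp, of l] by (simp add: scaleR_sum_right)
    then show "\<forall>m\<in>Poly_Mapping.keys p. (\<Sum>i\<in>I. Poly_Mapping.lookup m i) = CARD('n)"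
      using mpoly_homogeneous[OF _ _ assms(1) p(1)] by blast
  qed (use p(1) in blast)
qed

text \<open>
  The alternating sum over the subsets of \<open>K\<close> is an iterated finite difference; this is one step of
  the iteration.
\<close>
lemma alternating_sum_insert:
  fixes F :: "'b set \<Rightarrow> real"
  assumes "finite K" "j \<notin> K"
  shows "(\<Sum>S\<in>Pow (insert j K). (-1) ^ card (insert j K - S) * F S)
       = (\<Sum>S\<in>Pow K. (-1) ^ card (K - S) * (F (insert j S) - F S))"
proof -
  have "inj_on (insert j) (Pow K)" "Pow K \<inter> insert j ` Pow K = {}"
    using assms(2) by (auto simp: inj_on_def)
  then have "(\<Sum>S\<in>Pow (insert j K). (-1) ^ card (insert j K - S) * F S) =
      (\<Sum>S\<in>Pow K. (-1) ^ card (insert j K - S) * F S) +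
      (\<Sum>S\<in>Pow K. (-1) ^ card (insert j K - insert j S) * F (insert j S))"
    using assms(1) by (simp add: Pow_insert sum.union_disjoint sum.reindex)
  moreover have "card (insert j K - S) = Suc (card (K - S))" "card (insert j K - insert j S) = card (K - S)"
    if "S \<in> Pow K" for S
  proof -
    have "insert j K - S = insert j (K - S)" "insert j K - insert j S = K - S"
      using that assms(2) by auto
    then show "card (insert j K - S) = Suc (card (K - S))" "card (insert j K - insert j S) = card (K - S)"
      using assms by simp_all
  qed
  ultimately show ?thesis
    by (simp add: sum.distrib[symmetric] algebra_simps)
qed

text \<open>
  Evaluating the variables in \<open>K\<close> at the vertices of the unit cube and summing with alternating signs
  turns the part of a monomial in these variables into \<open>\<Prod>i\<in>K. (1 - 0 ^ m\<^sub>i)\<close>.  So exactly the monomials that contain every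
  variable of \<open>K\<close> survive.
\<close>
lemma alternating_sum_mpoly:
  assumes "finite I" "K \<subseteq> I"
    and keys: "\<forall>m\<in>Poly_Mapping.keys p. Poly_Mapping.keys m \<subseteq> I"
  shows "(\<Sum>S\<in>Pow K. (-1) ^ card (K - S) * mpoly_eval p (\<lambda>i. if i \<in> K then of_bool (i \<in> S) else y i))
       = (\<Sum>m\<in>{m \<in> Poly_Mapping.keys p. \<forall>i\<in>K. Poly_Mapping.lookup m i > 0}.
            Poly_Mapping.lookup p m * (\<Prod>i\<in>I - K. y i ^ Poly_Mapping.lookup m i))"
proof -
  let ?K = "Poly_Mapping.keys p"
  have K: "finite K" using assms finite_subset by blast
  define c where "c = (\<lambda>m. Poly_Mapping.lookup p m * (\<Prod>i\<in>I - K. y i ^ Poly_Mapping.lookup m i))"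
  have vertex: "(\<Sum>S\<in>Pow K. (-1) ^ card (K - S) * (\<Prod>i\<in>K. of_bool (i \<in> S) ^ Poly_Mapping.lookup m i))
      = (of_bool (\<forall>i\<in>K. Poly_Mapping.lookup m i > 0) :: real)" for m
  proof -
    have "(\<Sum>S\<in>Pow K. (-1) ^ card (K - S) * (\<Prod>i\<in>K. of_bool (i \<in> S) ^ Poly_Mapping.lookup m i)) =
        (\<Sum>S\<in>Pow K. (\<Prod>i\<in>S. 1) * (\<Prod>i\<in>K - S. - (0 ^ Poly_Mapping.lookup m i)) :: real)"
    proof (intro sum.cong refl)
      fix S assume "S \<in> Pow K"
      then have "(\<Prod>i\<in>K. of_bool (i \<in> S) ^ Poly_Mapping.lookup m i) =
          (\<Prod>i\<in>S. 1) * (\<Prod>i\<in>K - S. 0 ^ Poly_Mapping.lookup m i :: real)"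
        using K by (subst prod.subset_diff[of S K]) auto
      then show "(-1) ^ card (K - S) * (\<Prod>i\<in>K. of_bool (i \<in> S) ^ Poly_Mapping.lookup m i) =
          (\<Prod>i\<in>S. 1) * (\<Prod>i\<in>K - S. - (0 ^ Poly_Mapping.lookup m i) :: real)"
        by (simp add: prod_uminus)
    qed
    also have "\<dots> = (\<Prod>i\<in>K. 1 + - (0 ^ Poly_Mapping.lookup m i))"
      by (rule prod_add[OF K, symmetric])
    also have "\<dots> = of_bool (\<forall>i\<in>K. Poly_Mapping.lookup m i > 0)"
      using K by (auto simp: power_0_left prod_zero_iff intro!: prod.neutral)
    finally show ?thesis .
  qed
  have eval: "mpoly_eval p (\<lambda>i. if i \<in> K then of_bool (i \<in> S) else y i) =
      (\<Sum>m\<in>?K. c m * (\<Prod>i\<in>K. of_bool (i \<in> S) ^ Poly_Mapping.lookup m i))" for S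
  proof -
    have "monomial_eval (\<lambda>i. if i \<in> K then of_bool (i \<in> S) else y i) m =
        (\<Prod>i\<in>I - K. y i ^ Poly_Mapping.lookup m i) * (\<Prod>i\<in>K. of_bool (i \<in> S) ^ Poly_Mapping.lookup m i)"
      if "m \<in> ?K" for m
      using assms(1,2) keys that
      by (simp add: monomial_eval_superset[of I] prod.subset_diff[of K I])
    then show ?thesis by (simp add: mpoly_eval_superset[of ?K] c_def mult.assoc)
  qed
  have "(\<Sum>S\<in>Pow K. (-1) ^ card (K - S) * mpoly_eval p (\<lambda>i. if i \<in> K then of_bool (i \<in> S) else y i))
      = (\<Sum>m\<in>?K. c m * (\<Sum>S\<in>Pow K. (-1) ^ card (K - S) * (\<Prod>i\<in>K. of_bool (i \<in> S) ^ Poly_Mapping.lookup m i)))"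
    unfolding eval sum_distrib_left by (subst sum.swap) (simp add: mult.left_commute)
  also have "\<dots> = (\<Sum>m\<in>{m \<in> ?K. \<forall>i\<in>K. Poly_Mapping.lookup m i > 0}. c m)"
    unfolding vertex by (simp add: sum.inter_filter of_bool_def if_distrib[of "\<lambda>x. _ * x"] cong: if_cong)
  finally show ?thesis by (simp add: c_def)
qed

lemma alternating_sum_moore_det:
  fixes B :: "nat \<Rightarrow> quat^'n^'n"
  assumes I: "finite I" "K \<subseteq> I"
    and keys: "\<forall>m\<in>Poly_Mapping.keys p. Poly_Mapping.keys m \<subseteq> I"
    and eval: "\<forall>l. mpoly_eval p l = moore_det (\<Sum>i\<in>I. l i *\<^sub>R B i)"
  shows "(\<Sum>S\<in>Pow K. (-1) ^ card (K - S) * moore_det ((\<Sum>i\<in>S. B i) + (\<Sum>i\<in>I - K. y i *\<^sub>R B i)))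
       = (\<Sum>m\<in>{m \<in> Poly_Mapping.keys p. \<forall>i\<in>K. Poly_Mapping.lookup m i > 0}.
            Poly_Mapping.lookup p m * (\<Prod>i\<in>I - K. y i ^ Poly_Mapping.lookup m i))"
proof -
  have K: "finite K" using I finite_subset by blast
  have "(\<Sum>i\<in>I. (if i \<in> K then of_bool (i \<in> S) else y i) *\<^sub>R B i) = (\<Sum>i\<in>S. B i) + (\<Sum>i\<in>I - K. y i *\<^sub>R B i)"
    if "S \<in> Pow K" for S
  proof -
    have "(\<Sum>i\<in>S. B i) = (\<Sum>i\<in>K. of_bool (i \<in> S) *\<^sub>R B i)"
      using that K by (intro sum.mono_neutral_cong_left) auto
    then show ?thesis
      using I by (subst sum.subset_diff[of K I]) auto
  qed
  then show ?thesis
    using alternating_sum_mpoly[OF I keys, of y] by (simp add: eval)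
qed

lemma eq_one_if_sum_eq_card:
  fixes f :: "'b \<Rightarrow> nat"
  assumes "finite I" "\<And>i. i \<in> I \<Longrightarrow> f i > 0" "(\<Sum>i\<in>I. f i) \<le> card I" "i \<in> I"
  shows "f i = 1"
proof -
  have "(\<Sum>i\<in>I. f i - 1) = (\<Sum>i\<in>I. f i) - (\<Sum>i\<in>I. 1)"
    using assms(2) by (intro sum_subtractf_nat) (simp add: Suc_leI)
  then have "(\<Sum>i\<in>I. f i - 1) = 0" using assms(3) by simp
  then show ?thesis using assms by (force simp: sum_eq_0_iff)
qed

text \<open>
  A monomial of degree \<open>n\<close> in \<open>n\<close> variables that contains all of them is their product.  So the
  finite difference in all directions is exactly the coefficient that defines the mixed discriminant.
\<close>
theorem mixed_discriminant_alternating_sum: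
  fixes A :: "nat \<Rightarrow> quat^'n^'n"
  assumes A: "\<forall>i\<in>{1..CARD('n)}. hyperhermitian (A i)"
  shows "fact CARD('n) * mixed_discriminant A =
     (\<Sum>S\<in>Pow {1..CARD('n)}. (-1) ^ card ({1..CARD('n)} - S) * moore_det (\<Sum>i\<in>S. A i))"
proof -
  let ?I = "{1..CARD('n)}"
  obtain p where keys: "\<forall>m\<in>Poly_Mapping.keys p. Poly_Mapping.keys m \<subseteq> ?I"
    and deg: "\<forall>m\<in>Poly_Mapping.keys p. (\<Sum>i\<in>?I. Poly_Mapping.lookup m i) = CARD('n)"
    and eval: "\<forall>l. mpoly_eval p l = moore_det (\<Sum>i\<in>?I. l i *\<^sub>R A i)"
    using moore_det_mpoly[OF finite_atLeastAtMost A] by blast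
  define e where "e = (\<Sum>i\<in>?I. Poly_Mapping.single i (1::nat))"
  have lookup_e: "Poly_Mapping.lookup e i = of_bool (i \<in> ?I)" for i
    by (simp add: e_def lookup_sum lookup_single when_def)
  have "(THE p. \<forall>l. mpoly_eval p l = moore_det (\<Sum>i\<in>?I. l i *\<^sub>R A i)) = p"
    using eval by (intro the_equality mpoly_eval_inj) auto
  then have "fact CARD('n) * mixed_discriminant A = Poly_Mapping.lookup p e"
    by (simp add: mixed_discriminant_def e_def)
  moreover have "m = e" if m: "m \<in> Poly_Mapping.keys p" "\<forall>i\<in>?I. Poly_Mapping.lookup m i > 0" for m
  proof (rule poly_mapping_eqI)
    fix i
    show "Poly_Mapping.lookup m i = Poly_Mapping.lookup e i"
    proof (cases "i \<in> ?I")
      case True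
      then show ?thesis
        using eq_one_if_sum_eq_card[of ?I "Poly_Mapping.lookup m" i] m deg by (simp add: lookup_e)
    next
      case False
      then have "i \<notin> Poly_Mapping.keys m" using keys m(1) by blast
      with False show ?thesis by (simp add: lookup_e in_keys_iff)
    qed
  qed
  then have "{m \<in> Poly_Mapping.keys p. \<forall>i\<in>?I. Poly_Mapping.lookup m i > 0} \<subseteq> {e}" by blast
  then have "(\<Sum>m\<in>{m \<in> Poly_Mapping.keys p. \<forall>i\<in>?I. Poly_Mapping.lookup m i > 0}. Poly_Mapping.lookup p m)
      = (\<Sum>m\<in>{e}. Poly_Mapping.lookup p m)"
    by (rule sum.mono_neutral_left[rotated]) (auto simp: in_keys_iff lookup_e)
  ultimately show ?thesis
    using alternating_sum_moore_det[OF finite_atLeastAtMost order_refl keys eval, of "\<lambda>_. 0"] by simp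
qed

lemma mixed_discriminant_permute:
  fixes A :: "nat \<Rightarrow> quat^'n^'n"
  assumes A: "\<forall>i\<in>{1..CARD('n)}. hyperhermitian (A i)"
    and f: "bij_betw f {1..CARD('n)} {1..CARD('n)}"
  shows "mixed_discriminant (\<lambda>i. A (f i)) = mixed_discriminant A"
proof -
  let ?I = "{1..CARD('n)}"
  have f': "inj_on f ?I" "f ` ?I = ?I" using f by (auto simp: bij_betw_def)
  have "(\<Sum>T\<in>Pow ?I. (-1) ^ card (?I - T) * moore_det (\<Sum>i\<in>T. A i)) =
      (\<Sum>S\<in>Pow ?I. (-1) ^ card (?I - f ` S) * moore_det (\<Sum>i\<in>f ` S. A i))"
    using bij_betw_Pow[OF f] by (rule sum.reindex_bij_betw[symmetric])
  also have "\<dots> = (\<Sum>S\<in>Pow ?I. (-1) ^ card (?I - S) * moore_det (\<Sum>i\<in>S. A (f i)))"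
  proof (intro sum.cong refl)
    fix S assume S: "S \<in> Pow ?I"
    have "?I - f ` S = f ` (?I - S)" using f' S by (simp add: inj_on_image_set_diff[of f ?I])
    then have "card (?I - f ` S) = card (?I - S)"
      using f'(1) by (simp add: card_image inj_on_diff)
    moreover have "(\<Sum>i\<in>f ` S. A i) = (\<Sum>i\<in>S. A (f i))"
      using f'(1) S by (simp add: sum.reindex inj_on_subset)
    ultimately show "(-1) ^ card (?I - f ` S) * moore_det (\<Sum>i\<in>f ` S. A i) =
        (-1) ^ card (?I - S) * moore_det (\<Sum>i\<in>S. A (f i))" by simp
  qed
  finally have alt: "(\<Sum>T\<in>Pow ?I. (-1) ^ card (?I - T) * moore_det (\<Sum>i\<in>T. A i)) =
      (\<Sum>S\<in>Pow ?I. (-1) ^ card (?I - S) * moore_det (\<Sum>i\<in>S. A (f i)))" .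
  have Af: "\<forall>i\<in>?I. hyperhermitian (A (f i))"
    using A f'(2) by blast
  from alt have "fact CARD('n) * mixed_discriminant A = fact CARD('n) * mixed_discriminant (\<lambda>i. A (f i))"
    using mixed_discriminant_alternating_sum[OF A] mixed_discriminant_alternating_sum[OF Af] by simp
  then show ?thesis by simp
qed

lemma mixed_discriminant_swap:
  fixes A :: "nat \<Rightarrow> quat^'n^'n"
  assumes A: "\<forall>i\<in>{1..CARD('n)}. i \<noteq> j \<longrightarrow> i \<noteq> k \<longrightarrow> hyperhermitian (A i)"
    and X: "hyperhermitian X" "hyperhermitian Y" and jk: "j \<in> {1..CARD('n)}" "k \<in> {1..CARD('n)}" "j \<noteq> k"
  shows "mixed_discriminant (A(j := X, k := Y)) = mixed_discriminant (A(j := Y, k := X))"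
proof -
  let ?A = "A(j := Y, k := X)" and ?f = "id(j := k, k := j)"
  have "bij_betw ?f {1..CARD('n)} {1..CARD('n)}"
    by (rule bij_betwI[of _ _ _ ?f]) (use jk in auto)
  moreover have "\<forall>i\<in>{1..CARD('n)}. hyperhermitian (?A i)"
    using A X by auto
  moreover have "(\<lambda>i. ?A (?f i)) = A(j := X, k := Y)" using jk by auto
  ultimately show ?thesis using mixed_discriminant_permute[of ?A ?f] by simp
qed

text \<open>
  Give \<open>X\<close> and \<open>Y\<close> a variable each and take finite differences in the other \<open>n - 1\<close> directions.
  The surviving monomials have degree \<open>n\<close> and contain those \<open>n - 1\<close> variables, so they are at
  most linear in the variables of \<open>X\<close> and \<open>Y\<close>.
\<close>
lemma mixed_discriminant_linear:
  fixes A :: "nat \<Rightarrow> quat^'n^'n"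
  assumes j: "j \<in> {1..CARD('n)}"
    and A: "\<forall>i\<in>{1..CARD('n)}. i \<noteq> j \<longrightarrow> hyperhermitian (A i)"
    and XY: "hyperhermitian X" "hyperhermitian Y"
  shows "mixed_discriminant (A(j := a *\<^sub>R X + b *\<^sub>R Y)) =
    a * mixed_discriminant (A(j := X)) + b * mixed_discriminant (A(j := Y))"
proof -
  let ?N = "CARD('n)"
  define K where "K = {1..?N} - {j}"
  define k where "k = Suc ?N"
  define I where "I = insert j (insert k K)"
  define B where "B = A(j := X, k := Y)"
  have I: "finite I" "K \<subseteq> I" "I - K = {j, k}" "j \<noteq> k" "finite K" "j \<notin> K" "k \<notin> K" "insert j K = {1..?N}"
    using j by (auto simp: I_def K_def k_def)
  have cK: "card K = ?N - 1" using j by (simp add: K_def)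
  have B: "\<forall>i\<in>I. hyperhermitian (B i)"
    using A XY by (auto simp: B_def I_def K_def k_def)
  obtain p where keys: "\<forall>m\<in>Poly_Mapping.keys p. Poly_Mapping.keys m \<subseteq> I"
    and deg: "\<forall>m\<in>Poly_Mapping.keys p. (\<Sum>i\<in>I. Poly_Mapping.lookup m i) = ?N"
    and eval: "\<forall>l. mpoly_eval p l = moore_det (\<Sum>i\<in>I. l i *\<^sub>R B i)"
    using moore_det_mpoly[OF I(1) B] by blast
  define M where "M = {m \<in> Poly_Mapping.keys p. \<forall>i\<in>K. Poly_Mapping.lookup m i > 0}"
  \<comment> \<open>The contribution of the monomial \<open>m\<close> to the finite difference in slot \<open>j\<close>.\<close>
  define t where "t = (\<lambda>a b m. a ^ Poly_Mapping.lookup m j * b ^ Poly_Mapping.lookup m k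
      - 0 ^ Poly_Mapping.lookup m j * 0 ^ Poly_Mapping.lookup m k :: real)"
  have F: "(\<Sum>S\<in>Pow K. (-1) ^ card (K - S) * moore_det ((\<Sum>i\<in>S. A i) + (a *\<^sub>R X + b *\<^sub>R Y)))
      = (\<Sum>m\<in>M. Poly_Mapping.lookup p m * (a ^ Poly_Mapping.lookup m j * b ^ Poly_Mapping.lookup m k))" for a b
  proof -
    have "(\<Sum>i\<in>S. B i) = (\<Sum>i\<in>S. A i)" if "S \<in> Pow K" for S
      by (rule sum.cong) (use that I in \<open>auto simp: B_def\<close>)
    then show ?thesis
      using alternating_sum_moore_det[OF I(1,2) keys eval, of "\<lambda>i. if i = j then a else b"] I(4)
      by (simp add: M_def I(3)) (simp add: B_def)
  qed
  have md: "fact ?N * mixed_discriminant (A(j := a *\<^sub>R X + b *\<^sub>R Y)) =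
      (\<Sum>m\<in>M. Poly_Mapping.lookup p m * t a b m)" for a b
  proof -
    let ?Z = "a *\<^sub>R X + b *\<^sub>R Y" and ?A = "A(j := a *\<^sub>R X + b *\<^sub>R Y)"
    have hyp: "\<forall>i\<in>{1..?N}. hyperhermitian (?A i)"
      using A XY by (auto intro: hyperhermitian_add hyperhermitian_scaleR)
    have sums: "(\<Sum>i\<in>insert j S. ?A i) = (\<Sum>i\<in>S. A i) + ?Z" "(\<Sum>i\<in>S. ?A i) = (\<Sum>i\<in>S. A i)"
      if "S \<in> Pow K" for S
    proof -
      have S: "j \<notin> S" "finite S" using that I finite_subset[of S K] by auto
      then show "(\<Sum>i\<in>S. ?A i) = (\<Sum>i\<in>S. A i)" by (intro sum.cong) auto
      then show "(\<Sum>i\<in>insert j S. ?A i) = (\<Sum>i\<in>S. A i) + ?Z" using S by (simp add: add.commute)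
    qed
    have "fact ?N * mixed_discriminant ?A =
        (\<Sum>S\<in>Pow K. (-1) ^ card (K - S) * (moore_det (\<Sum>i\<in>insert j S. ?A i) - moore_det (\<Sum>i\<in>S. ?A i)))"
      unfolding mixed_discriminant_alternating_sum[of ?A, OF hyp]
      using alternating_sum_insert[OF I(5,6), of "\<lambda>S. moore_det (\<Sum>i\<in>S. ?A i)"] by (simp only: I(8))
    also have "\<dots> = (\<Sum>S\<in>Pow K. (-1) ^ card (K - S) * moore_det ((\<Sum>i\<in>S. A i) + ?Z))
        - (\<Sum>S\<in>Pow K. (-1) ^ card (K - S) * moore_det ((\<Sum>i\<in>S. A i) + (0 *\<^sub>R X + 0 *\<^sub>R Y)))"
      unfolding sum_subtractf[symmetric]
      by (intro sum.cong refl) (simp add: sums right_diff_distrib del: fun_upd_apply)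
    also have "\<dots> = (\<Sum>m\<in>M. Poly_Mapping.lookup p m * t a b m)"
      unfolding F by (simp add: t_def right_diff_distrib sum_subtractf)
    finally show ?thesis .
  qed
  have lin: "t a b m = a * t 1 0 m + b * t 0 1 m" if m: "m \<in> M" for m
  proof -
    have "card K \<le> (\<Sum>i\<in>K. Poly_Mapping.lookup m i)"
      using m sum_mono[of K "\<lambda>_. 1" "Poly_Mapping.lookup m"] by (simp add: M_def Suc_leI)
    moreover have "(\<Sum>i\<in>I. Poly_Mapping.lookup m i) = Poly_Mapping.lookup m j + Poly_Mapping.lookup m k + (\<Sum>i\<in>K. Poly_Mapping.lookup m i)"
      using I by (simp add: I_def)
    ultimately have "Poly_Mapping.lookup m j + Poly_Mapping.lookup m k \<le> 1"
      using deg m cK by (simp add: M_def)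
    then consider "Poly_Mapping.lookup m j = 0" "Poly_Mapping.lookup m k = 0"
      | "Poly_Mapping.lookup m j = 1" "Poly_Mapping.lookup m k = 0"
      | "Poly_Mapping.lookup m j = 0" "Poly_Mapping.lookup m k = 1" by linarith
    then show ?thesis by cases (simp_all add: t_def)
  qed
  have "fact ?N * mixed_discriminant (A(j := a *\<^sub>R X + b *\<^sub>R Y)) =
      a * (fact ?N * mixed_discriminant (A(j := 1 *\<^sub>R X + 0 *\<^sub>R Y))) +
      b * (fact ?N * mixed_discriminant (A(j := 0 *\<^sub>R X + 1 *\<^sub>R Y)))"
    unfolding md sum_distrib_left sum.distrib[symmetric]
    by (intro sum.cong refl) (subst lin, auto simp: algebra_simps)
  then have "fact ?N * mixed_discriminant (A(j := a *\<^sub>R X + b *\<^sub>R Y)) =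
      fact ?N * (a * mixed_discriminant (A(j := X)) + b * mixed_discriminant (A(j := Y)))"
    by (simp add: algebra_simps)
  then show ?thesis by simp
qed

text \<open>
  The same principle with two equal arguments \<open>z C + w X\<close>: finite differences in the other \<open>n - 2\<close>
  directions leave a polynomial of degree at most 2 in \<open>z\<close> and \<open>w\<close>, and the second difference
  \<open>G(2 z, 2 w) - 2 G(z, w) + G(0, 0)\<close> of it is twice its quadratic part.
\<close>
lemma mixed_discriminant_equal_pair:
  fixes A :: "nat \<Rightarrow> quat^'n^'n"
  assumes jk: "j \<in> {1..CARD('n)}" "k \<in> {1..CARD('n)}" "j \<noteq> k"
    and A: "\<forall>i\<in>{1..CARD('n)}. i \<noteq> j \<longrightarrow> i \<noteq> k \<longrightarrow> hyperhermitian (A i)"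
    and CX: "hyperhermitian C" "hyperhermitian X"
    and keys: "\<forall>m\<in>Poly_Mapping.keys p. Poly_Mapping.keys m \<subseteq> {1..CARD('n)}"
    and deg: "\<forall>m\<in>Poly_Mapping.keys p. (\<Sum>i\<in>{1..CARD('n)}. Poly_Mapping.lookup m i) = CARD('n)"
    and eval: "\<forall>l. mpoly_eval p l = moore_det (\<Sum>i\<in>{1..CARD('n)}. l i *\<^sub>R (A(j := C, k := X)) i)"
  shows "fact CARD('n) * mixed_discriminant (A(j := z *\<^sub>R C + w *\<^sub>R X, k := z *\<^sub>R C + w *\<^sub>R X)) =
    2 * (\<Sum>m\<in>{m \<in> Poly_Mapping.keys p. \<forall>i\<in>{1..CARD('n)} - {j, k}. Poly_Mapping.lookup m i = 1}.
      Poly_Mapping.lookup p m * (z ^ Poly_Mapping.lookup m j * w ^ Poly_Mapping.lookup m k))"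
proof -
  define I where "I = {1..CARD('n)}"
  define K where "K = I - {j, k}"
  define B where "B = A(j := C, k := X)"
  define Y where "Y = z *\<^sub>R C + w *\<^sub>R X"
  define D where "D = A(j := Y, k := Y)"
  define M where "M = {m \<in> Poly_Mapping.keys p. \<forall>i\<in>K. Poly_Mapping.lookup m i > 0}"
  have I: "finite I" "K \<subseteq> I" "I - K = {j, k}" "finite K" "j \<notin> insert k K" "k \<notin> K"
    "insert j (insert k K) = I" "card I = CARD('n)"
    using jk by (auto simp: I_def K_def)
  have D: "\<forall>i\<in>I. hyperhermitian (D i)"
    using A CX by (auto simp: D_def Y_def I_def intro: hyperhermitian_add hyperhermitian_scaleR)
  define G where "G = (\<lambda>a b. \<Sum>m\<in>M. Poly_Mapping.lookup p m * (a ^ Poly_Mapping.lookup m j * b ^ Poly_Mapping.lookup m k) :: real)"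
  have G: "G a b = (\<Sum>S\<in>Pow K. (-1) ^ card (K - S) * moore_det ((\<Sum>i\<in>S. A i) + (a *\<^sub>R C + b *\<^sub>R X)))" for a b
  proof -
    have "(\<Sum>i\<in>S. B i) = (\<Sum>i\<in>S. A i)" if "S \<in> Pow K" for S
      by (rule sum.cong) (use that I in \<open>auto simp: B_def\<close>)
    then show ?thesis
      using alternating_sum_moore_det[OF I(1,2) keys[folded I_def] eval[folded I_def B_def],
          of "\<lambda>i. if i = j then a else b"] jk(3)
      by (simp add: G_def M_def I(3)) (simp add: B_def)
  qed
  have sums: "(\<Sum>i\<in>insert j (insert k S). D i) = (\<Sum>i\<in>S. A i) + ((2 * z) *\<^sub>R C + (2 * w) *\<^sub>R X)"
    "(\<Sum>i\<in>insert j S. D i) = (\<Sum>i\<in>S. A i) + (z *\<^sub>R C + w *\<^sub>R X)"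
    "(\<Sum>i\<in>insert k S. D i) = (\<Sum>i\<in>S. A i) + (z *\<^sub>R C + w *\<^sub>R X)"
    "(\<Sum>i\<in>S. D i) = (\<Sum>i\<in>S. A i) + (0 *\<^sub>R C + 0 *\<^sub>R X)" if "S \<in> Pow K" for S
  proof -
    have S: "j \<notin> S" "k \<notin> S" "finite S" using that I finite_subset[of S K] by auto
    have "(\<Sum>i\<in>S. D i) = (\<Sum>i\<in>S. A i)" using S by (intro sum.cong) (auto simp: D_def)
    moreover have "D j = Y" "D k = Y" by (auto simp: D_def)
    moreover have "Y + Y = (2 * z) *\<^sub>R C + (2 * w) *\<^sub>R X"
      by (simp add: Y_def scaleR_2[symmetric] scaleR_right_distrib)
    ultimately have
      "(\<Sum>i\<in>insert k S. D i) = (\<Sum>i\<in>S. A i) + Y"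
      "(\<Sum>i\<in>insert j S. D i) = (\<Sum>i\<in>S. A i) + Y"
      "(\<Sum>i\<in>insert j (insert k S). D i) = (\<Sum>i\<in>S. A i) + (Y + Y)"
      "(\<Sum>i\<in>S. D i) = (\<Sum>i\<in>S. A i)"
      "Y + Y = (2 * z) *\<^sub>R C + (2 * w) *\<^sub>R X"
      using S jk(3) by (simp_all add: add_ac)
    then show "(\<Sum>i\<in>insert j (insert k S). D i) = (\<Sum>i\<in>S. A i) + ((2 * z) *\<^sub>R C + (2 * w) *\<^sub>R X)"
      "(\<Sum>i\<in>insert j S. D i) = (\<Sum>i\<in>S. A i) + (z *\<^sub>R C + w *\<^sub>R X)"
      "(\<Sum>i\<in>insert k S. D i) = (\<Sum>i\<in>S. A i) + (z *\<^sub>R C + w *\<^sub>R X)"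
      "(\<Sum>i\<in>S. D i) = (\<Sum>i\<in>S. A i) + (0 *\<^sub>R C + 0 *\<^sub>R X)"
      by (simp_all only: Y_def) simp
  qed
  have "fact CARD('n) * mixed_discriminant D = (\<Sum>S\<in>Pow I. (-1) ^ card (I - S) * moore_det (\<Sum>i\<in>S. D i))"
    using mixed_discriminant_alternating_sum[of D] D by (simp only: I_def)
  also have "\<dots> = (\<Sum>S\<in>Pow K. (-1) ^ card (K - S) *
      ((moore_det (\<Sum>i\<in>insert j (insert k S). D i) - moore_det (\<Sum>i\<in>insert k S. D i))
      - (moore_det (\<Sum>i\<in>insert j S. D i) - moore_det (\<Sum>i\<in>S. D i))))"
    using alternating_sum_insert[OF finite.insertI[OF I(4)] I(5), of "\<lambda>S. moore_det (\<Sum>i\<in>S. D i)"]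
      alternating_sum_insert[OF I(4,6), of "\<lambda>S. moore_det (\<Sum>i\<in>insert j S. D i) - moore_det (\<Sum>i\<in>S. D i)"]
    by (simp only: I(7))
  also have "\<dots> = G (2 * z) (2 * w) - G z w - (G z w - G 0 0)"
    unfolding G sum_subtractf[symmetric]
    by (intro sum.cong refl) (simp only: sums right_diff_distrib)
  also have "\<dots> = (\<Sum>m\<in>M. if \<forall>i\<in>K. Poly_Mapping.lookup m i = 1 then
      2 * (Poly_Mapping.lookup p m * (z ^ Poly_Mapping.lookup m j * w ^ Poly_Mapping.lookup m k)) else 0)"
    unfolding G_def sum_subtractf[symmetric]
  proof (intro sum.cong refl)
    fix m assume m: "m \<in> M"
    let ?a = "Poly_Mapping.lookup m j" and ?b = "Poly_Mapping.lookup m k"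
    have sumI: "?a + ?b + (\<Sum>i\<in>K. Poly_Mapping.lookup m i) = card K + 2"
    proof -
      have "(\<Sum>i\<in>I. Poly_Mapping.lookup m i) = ?a + ?b + (\<Sum>i\<in>K. Poly_Mapping.lookup m i)"
        using I(4-6) by (subst I(7)[symmetric]) simp
      moreover have "card I = card K + 2" using I(4-6) by (subst I(7)[symmetric]) simp
      ultimately show ?thesis using deg m I(8) by (simp add: M_def I_def)
    qed
    have K_le: "card K \<le> (\<Sum>i\<in>K. Poly_Mapping.lookup m i)"
      using m sum_mono[of K "\<lambda>_. 1" "Poly_Mapping.lookup m"] by (simp add: M_def Suc_leI)
    show "Poly_Mapping.lookup p m * ((2 * z) ^ ?a * (2 * w) ^ ?b) - Poly_Mapping.lookup p m * (z ^ ?a * w ^ ?b)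
        - (Poly_Mapping.lookup p m * (z ^ ?a * w ^ ?b) - Poly_Mapping.lookup p m * (0 ^ ?a * 0 ^ ?b))
      = (if \<forall>i\<in>K. Poly_Mapping.lookup m i = 1 then 2 * (Poly_Mapping.lookup p m * (z ^ ?a * w ^ ?b)) else 0)"
    proof (cases "\<forall>i\<in>K. Poly_Mapping.lookup m i = 1")
      case True
      then have "?a + ?b = 2" using sumI by simp
      then have "(2::real) ^ ?a * 2 ^ ?b = 4" "(0::real) ^ ?a * 0 ^ ?b = 0"
        by (simp_all flip: power_add)
      moreover have "(2 * z) ^ ?a * (2 * w) ^ ?b = (2 ^ ?a * 2 ^ ?b) * (z ^ ?a * w ^ ?b)"
        by (simp add: power_mult_distrib mult_ac)
      ultimately show ?thesis using True by (simp add: algebra_simps)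
    next
      case False
      then have "card K < (\<Sum>i\<in>K. Poly_Mapping.lookup m i)"
        using eq_one_if_sum_eq_card[OF I(4), of "Poly_Mapping.lookup m"] m K_le
        by (force simp: M_def)
      then have "?a + ?b \<le> 1" using sumI by simp
      then consider "?a = 0" "?b = 0" | "?a = 1" "?b = 0" | "?a = 0" "?b = 1" by linarith
      then show ?thesis unfolding if_not_P[OF False] by cases (simp_all add: algebra_simps)
    qed
  qed
  also have "\<dots> = (\<Sum>m\<in>{m \<in> Poly_Mapping.keys p. \<forall>i\<in>K. Poly_Mapping.lookup m i = 1}.
      2 * (Poly_Mapping.lookup p m * (z ^ Poly_Mapping.lookup m j * w ^ Poly_Mapping.lookup m k)))"
    by (subst sum.inter_filter[symmetric]) (auto simp: M_def intro!: sum.cong)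
  finally show ?thesis
    by (simp add: D_def Y_def K_def I_def sum_distrib_left)
qed

section \<open>Stable polynomials and extraction of coefficients\<close>

text \<open>
  The quotient is the logarithmic derivative of \<open>u\<close> at 0, which is the sum of \<open>- 1 / r\<close> over the zeros
  \<open>r\<close>; each term has positive real part.  In particular the linear coefficient of a nonconstant \<open>u\<close>
  does not vanish.
\<close>
lemma hurwitz_log_derivative:
  fixes u :: "complex poly"
  assumes "\<And>s. poly u s = 0 \<Longrightarrow> Re s < 0"
  shows "coeff u 0 \<noteq> 0 \<and> Re (coeff u 1 / coeff u 0) \<ge> 0 \<and> (degree u > 0 \<longrightarrow> Re (coeff u 1 / coeff u 0) > 0)"
  using assms
proof (induction "degree u" arbitrary: u)
  case 0
  have "poly u 0 \<noteq> 0" using 0(2)[of 0] by auto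
  moreover have "coeff u 1 = 0" using 0(1) by (simp add: coeff_eq_0)
  ultimately show ?case using 0(1) by (simp add: poly_0_coeff_0)
next
  case (Suc n)
  then have "\<not> constant (poly u)" by (simp add: constant_degree)
  then obtain r where r: "poly u r = 0" using fundamental_theorem_of_algebra by blast
  then obtain v where u: "u = [:- r, 1:] * v" by (metis dvdE poly_eq_0_iff_dvd)
  with Suc.hyps(2) have "v \<noteq> 0" by auto
  then have "degree u = Suc (degree v)" unfolding u by (subst degree_mult_eq) auto
  then have "n = degree v" using Suc.hyps(2) by simp
  moreover have "Re s < 0" if "poly v s = 0" for s using Suc.prems[of s] that by (simp add: u)
  ultimately have IH: "coeff v 0 \<noteq> 0" "Re (coeff v 1 / coeff v 0) \<ge> 0" using Suc.hyps(1)[of v] by auto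
  have "Re r < 0" using Suc.prems[OF r] .
  then have r0: "r \<noteq> 0" and "Re (- 1 / r) > 0" by (auto simp: Re_divide divide_neg_pos power2_eq_square add_nonneg_pos add_pos_nonneg sum_squares_gt_zero_iff)
  have c: "coeff u 0 = - r * coeff v 0" "coeff u 1 = coeff v 0 - r * coeff v 1"
    by (simp_all add: u)
  then have "coeff u 1 / coeff u 0 = - 1 / r + coeff v 1 / coeff v 0"
    using r0 IH(1) by (simp add: field_simps)
  then show ?case using c(1) r0 IH \<open>Re (- 1 / r) > 0\<close> by simp
qed

text \<open>
  The coefficient of \<open>\<Prod>i\<in>K. z\<^sub>i\<close> in \<open>p\<close>, as a polynomial in the variables of \<open>I - K\<close>.
\<close>
definition multilinear_part ::
  "nat set \<Rightarrow> nat set \<Rightarrow> ((nat \<Rightarrow>\<^sub>0 nat) \<Rightarrow>\<^sub>0 real) \<Rightarrow> (nat \<Rightarrow> complex) \<Rightarrow> complex" where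
  "multilinear_part I K p z =
     (\<Sum>m\<in>{m \<in> Poly_Mapping.keys p. \<forall>i\<in>K. Poly_Mapping.lookup m i = 1}.
        of_real (Poly_Mapping.lookup p m) * (\<Prod>i\<in>I - K. z i ^ Poly_Mapping.lookup m i))"

text \<open>
  The region of nonvanishing: \<open>J\<close> indexes the positive definite matrices and \<open>x\<close> the one matrix that
  is merely hyperhermitian.
\<close>
definition right_half_plane_point :: "nat set \<Rightarrow> nat \<Rightarrow> (nat \<Rightarrow> complex) \<Rightarrow> bool" where
  "right_half_plane_point J x z \<longleftrightarrow>
     (\<forall>i\<in>J. Re (z i) \<ge> 0) \<and> (\<exists>i\<in>J. Re (z i) > 0) \<and> Re (z x) = 0"

text \<open>
  Variables are moved into \<open>K\<close> one at a time.  Regarded as a polynomial \<open>u\<close> in the variable \<open>z\<^sub>k\<close>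
  alone, the previous coefficient has no zero in the closed right half plane.  Its linear
  coefficient, which is the next coefficient to be treated, is therefore nonzero as soon as \<open>u\<close> is
  not constant.  Homogeneity gives that: the top coefficient of \<open>u\<close> is the value of the previous
  coefficient at the unit vector of \<open>k\<close>, which is itself a point of the region.
\<close>
lemma multilinear_part_nonzero:
  assumes I: "finite I" "x \<in> I"
    and deg: "\<forall>m\<in>Poly_Mapping.keys p. (\<Sum>i\<in>I. Poly_Mapping.lookup m i) = card I"
    and base: "\<forall>z. right_half_plane_point (I - {x}) x z \<longrightarrow> multilinear_part I {} p z \<noteq> 0"
    and K: "K \<subset> I - {x}"
    and z: "right_half_plane_point (I - {x} - K) x z"
  shows "multilinear_part I K p z \<noteq> 0"
proof -
  have "finite K" using I K finite_subset by blast
  then show ?thesis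
    using K z
  proof (induction K arbitrary: z)
    case empty
    then show ?case using base by simp
  next
    case (insert k K)
    have k: "k \<in> I" "k \<noteq> x" "k \<notin> K" "K \<subset> I - {x}" "K \<subseteq> I" using insert by auto
    define M where "M = {m \<in> Poly_Mapping.keys p. \<forall>i\<in>K. Poly_Mapping.lookup m i = 1}"
    define J where "J = I - insert k K"
    have IK: "I - K = insert k J" "k \<notin> J" "finite J" "finite M" using k I by (auto simp: J_def M_def)
    define c where "c = (\<lambda>m. of_real (Poly_Mapping.lookup p m) * (\<Prod>i\<in>J. z i ^ Poly_Mapping.lookup m i))"
    define u where "u = (\<Sum>m\<in>M. monom (c m) (Poly_Mapping.lookup m k))"
    have poly_u: "poly u s = multilinear_part I K p (z(k := s))" for s
    proof -
      have "(\<Prod>i\<in>J. (z(k := s)) i ^ Poly_Mapping.lookup m i) = (\<Prod>i\<in>J. z i ^ Poly_Mapping.lookup m i)" for m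
        using IK(2) by (intro prod.cong) auto
      then show ?thesis
        using IK by (simp add: u_def multilinear_part_def poly_sum poly_monom c_def M_def mult_ac del: fun_upd_apply)
          (simp add: mult_ac)
    qed
    have "Re s < 0" if "poly u s = 0" for s
    proof (rule ccontr)
      assume "\<not> Re s < 0"
      then have "right_half_plane_point (I - {x} - K) x (z(k := s))"
        using insert.prems(2) k unfolding right_half_plane_point_def by (auto simp: not_less)
      then show False using insert.IH[OF k(4)] that poly_u by auto
    qed
    then have hurwitz: "degree u > 0 \<longrightarrow> coeff u 1 \<noteq> 0"
      using hurwitz_log_derivative[of u] by auto
    define d where "d = card (I - K)"
    have "right_half_plane_point (I - {x} - K) x (\<lambda>i. of_bool (i = k))"
      using k by (auto simp: right_half_plane_point_def)
    then have "multilinear_part I K p (\<lambda>i. of_bool (i = k)) \<noteq> 0"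
      by (rule insert.IH[OF k(4)])
    moreover have "coeff u d = multilinear_part I K p (\<lambda>i. of_bool (i = k))"
    proof -
      have "(if Poly_Mapping.lookup m k = d then c m else 0) =
          of_real (Poly_Mapping.lookup p m) * (\<Prod>i\<in>I - K. of_bool (i = k) ^ Poly_Mapping.lookup m i)"
        if m: "m \<in> M" for m
      proof -
        have "(\<Sum>i\<in>I. Poly_Mapping.lookup m i) = (\<Sum>i\<in>I - K. Poly_Mapping.lookup m i) + (\<Sum>i\<in>K. Poly_Mapping.lookup m i)"
          using k(5) I(1) by (rule sum.subset_diff)
        moreover have "(\<Sum>i\<in>K. Poly_Mapping.lookup m i) = card K" using m by (simp add: M_def)
        moreover have "card I = d + card K"
          using k(5) I(1) by (simp add: d_def card_Diff_subset finite_subset card_mono)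
        ultimately have d: "Poly_Mapping.lookup m k + (\<Sum>i\<in>J. Poly_Mapping.lookup m i) = d"
          using deg m IK by (simp add: M_def)
        have prod: "(\<Prod>i\<in>I - K. of_bool (i = k) ^ Poly_Mapping.lookup m i) = (\<Prod>i\<in>J. 0 ^ Poly_Mapping.lookup m i :: complex)"
          using IK by (simp, intro prod.cong) auto
        show ?thesis
        proof (cases "Poly_Mapping.lookup m k = d")
          case True
          then have "\<forall>i\<in>J. Poly_Mapping.lookup m i = 0" using d IK(3) by simp
          then show ?thesis using True prod by (simp add: c_def)
        next
          case False
          then have "(\<Sum>i\<in>J. Poly_Mapping.lookup m i) \<noteq> 0" using d by simp
          then obtain i where "i \<in> J" "Poly_Mapping.lookup m i \<noteq> 0"
            using sum.not_neutral_contains_not_neutral by blast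
          then have "(\<Prod>i\<in>J. 0 ^ Poly_Mapping.lookup m i :: complex) = 0" using IK(3) by (auto simp: prod_zero_iff)
          then show ?thesis using False prod by simp
        qed
      qed
      then show ?thesis by (simp add: u_def coeff_sum multilinear_part_def M_def)
    qed
    ultimately have "d \<le> degree u" by (intro le_degree) simp
    moreover have "d > 0" using IK by (simp add: d_def)
    ultimately have "coeff u 1 \<noteq> 0" using hurwitz by simp
    moreover have "coeff u 1 = multilinear_part I (insert k K) p z"
    proof -
      have "{m \<in> M. Poly_Mapping.lookup m k = 1} = {m \<in> Poly_Mapping.keys p. \<forall>i\<in>insert k K. Poly_Mapping.lookup m i = 1}"
        by (auto simp: M_def)
      then show ?thesis
        using sum.inter_filter[OF IK(4), of c "\<lambda>m. Poly_Mapping.lookup m k = 1"]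
        unfolding u_def multilinear_part_def c_def J_def[symmetric] by (simp add: coeff_sum)
    qed
    ultimately show ?case by simp
  qed
qed

section \<open>Stability of the Moore determinant\<close>

lemma inner_sum_matrix_vector:
  fixes y :: "real^'m"
  shows "y \<bullet> ((\<Sum>i\<in>S. f i) *v y) = (\<Sum>i\<in>S. y \<bullet> (f i *v y))"
  by (induction S rule: infinite_finite_induct)
    (simp_all add: matrix_vector_mult_add_rdistrib inner_add_right)

lemma symmetric_form:
  fixes M :: "real^'m^'m"
  assumes "transpose M = M"
  shows "x \<bullet> (M *v y) = y \<bullet> (M *v x)"
  by (metis assms dot_lmul_matrix inner_commute transpose_matrix_vector)

text \<open>
  If \<open>(M + i N) (a + i b) = 0\<close> then \<open>M a = N b\<close> and \<open>M b = - N a\<close>.  By symmetry of \<open>N\<close> the sum of the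
  two quadratic form values \<open>a \<bullet> M a + b \<bullet> M b\<close> is 0, so \<open>a = b = 0\<close>.
\<close>
lemma det_complexification_nonzero:
  fixes M N :: "real^'m^'m"
  assumes sym: "transpose N = N" and pos: "\<And>x. x \<noteq> 0 \<Longrightarrow> x \<bullet> (M *v x) > 0"
  shows "det ((\<chi> i j. of_real (M $ i $ j) + \<i> * of_real (N $ i $ j)) :: complex^'m^'m) \<noteq> 0"
proof -
  let ?Z = "(\<chi> i j. of_real (M $ i $ j) + \<i> * of_real (N $ i $ j)) :: complex^'m^'m"
  have "w = 0" if w: "?Z *v w = 0" for w
  proof -
    define a b where "a = (\<chi> i. Re (w $ i))" and "b = (\<chi> i. Im (w $ i))"
    have "(?Z *v w) $ i = 0" for i using w by simp
    then have "Re ((?Z *v w) $ i) = 0" "Im ((?Z *v w) $ i) = 0" for i by simp_all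
    then have "M *v a - N *v b = 0" "M *v b + N *v a = 0"
      by (simp_all add: vec_eq_iff matrix_vector_mult_def a_def b_def algebra_simps
          flip: sum_subtractf sum.distrib)
    then have "M *v a = N *v b" "M *v b = - (N *v a)"
      by (auto simp: add_eq_0_iff)
    then have "a \<bullet> (M *v a) + b \<bullet> (M *v b) = 0"
      using symmetric_form[OF sym, of a b] by simp
    moreover have "a \<bullet> (M *v a) \<ge> 0" "b \<bullet> (M *v b) \<ge> 0"
      using pos by (metis inner_zero_left less_eq_real_def)+
    ultimately have "a = 0" "b = 0"
      using pos[of a] pos[of b] by (cases "a = 0"; cases "b = 0"; simp)+
    then show "w = 0" by (simp add: a_def b_def vec_eq_iff complex_eq_iff)
  qed
  then have "invertible ?Z"
    using matrix_left_invertible_ker[of ?Z] invertible_left_inverse[of ?Z] by blast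
  then show ?thesis by (simp add: invertible_det_nz)
qed

text \<open>
  The fourth power of the Moore determinant is the determinant of the realification on real
  combinations.  Along the line \<open>U + s W\<close>, with \<open>U\<close> and \<open>W\<close> formed from the real and the imaginary
  parts of \<open>z\<close>, both sides are polynomials in \<open>s\<close>, so the identity persists at \<open>s = i\<close>.  There the
  determinant is nonzero because \<open>U\<close> is positive definite.
\<close>
lemma mpoly_nonzero_right_half_plane:
  fixes B :: "nat \<Rightarrow> quat^'n^'n"
  assumes I: "finite I" "x \<in> I"
    and keys: "\<forall>m\<in>Poly_Mapping.keys p. Poly_Mapping.keys m \<subseteq> I"
    and eval: "\<forall>l. mpoly_eval p l = moore_det (\<Sum>i\<in>I. l i *\<^sub>R B i)"
    and B: "\<forall>i\<in>I. hyperhermitian (B i)" "\<forall>i\<in>I - {x}. positive_definite (B i)"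
    and z: "right_half_plane_point (I - {x}) x z"
  shows "multilinear_part I {} p z \<noteq> 0"
proof -
  obtain P :: "quat^'n^'n \<Rightarrow> real" where P: "moore_polynomial P" using ex_moore_polynomial by blast
  define U where "U = (\<Sum>i\<in>I. Re (z i) *\<^sub>R B i)"
  define W where "W = (\<Sum>i\<in>I. Im (z i) *\<^sub>R B i)"
  define u where "u = (\<Sum>m\<in>Poly_Mapping.keys p. smult (of_real (Poly_Mapping.lookup p m))
    (\<Prod>i\<in>I. [:of_real (Re (z i)), of_real (Im (z i)):] ^ Poly_Mapping.lookup m i) :: complex poly)"
  define d where "d = (det (\<chi> i j. [:of_real (realification U $ i $ j), of_real (realification W $ i $ j):]) :: complex poly)"
  have poly_d: "poly d s = det (\<chi> i j. of_real (realification U $ i $ j) + s * of_real (realification W $ i $ j))" for s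
    by (simp add: d_def det_def poly_sum poly_prod poly_of_int)
  have hyp: "hyperhermitian (U + s *\<^sub>R W)" for s
    unfolding U_def W_def using B
    by (intro hyperhermitian_add hyperhermitian_scaleR hyperhermitian_sum) auto
  have "poly u (of_real s) ^ 4 = poly d (of_real s)" for s
  proof -
    have "poly u (of_real s) = of_real (mpoly_eval p (\<lambda>i. Re (z i) + s * Im (z i)))"
      using I keys by (simp add: u_def poly_sum poly_prod mpoly_eval_superset[of "Poly_Mapping.keys p"]
          monomial_eval_superset[of I])
    also have "(\<Sum>i\<in>I. (Re (z i) + s * Im (z i)) *\<^sub>R B i) = U + s *\<^sub>R W"
      by (simp add: U_def W_def scaleR_left_distrib scaleR_sum_right sum.distrib)
    then have "mpoly_eval p (\<lambda>i. Re (z i) + s * Im (z i)) = P (U + s *\<^sub>R W)"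
      using eval moore_det_eq[OF P hyp, of s] by simp
    finally have "poly u (of_real s) ^ 4 = of_real (det (realification (U + s *\<^sub>R W)))"
      using P hyp[of s] by (simp add: moore_polynomial_def)
    also have "\<dots> = poly d (of_real s)"
      unfolding poly_d by (simp add: det_def realification_add realification_scaleR)
    finally show ?thesis .
  qed
  then have "range complex_of_real \<subseteq> {s. poly (u ^ 4 - d) s = 0}" by auto
  moreover have "infinite (range complex_of_real)"
    using finite_imageD[of complex_of_real UNIV] infinite_UNIV_char_0 inj_of_real by blast
  ultimately have "u ^ 4 - d = 0" using poly_roots_finite finite_subset by blast
  then have "poly u \<i> ^ 4 = poly d \<i>" by (metis eq_iff_diff_eq_0 poly_power)
  moreover have "poly u \<i> = multilinear_part I {} p z"
    by (simp add: u_def multilinear_part_def poly_sum poly_prod complex_eq[of "z _", symmetric] mult.commute)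
  moreover have "poly d \<i> \<noteq> 0"
    unfolding poly_d
  proof (rule det_complexification_nonzero)
    show "transpose (realification W) = realification W"
      using B unfolding W_def by (intro transpose_realification hyperhermitian_sum hyperhermitian_scaleR) auto
    fix y :: "real^('n \<times> 4)" assume y: "y \<noteq> 0"
    have form: "y \<bullet> (realification U *v y) = (\<Sum>i\<in>I. Re (z i) * (y \<bullet> (realification (B i) *v y)))"
      unfolding U_def realification_sum realification_scaleR inner_sum_matrix_vector
      by (simp flip: scaleR_matrix_vector_assoc)
    have pos: "y \<bullet> (realification (B i) *v y) > 0" if "i \<in> I - {x}" for i
      using B(2) that y positive_definite_realification by blast
    obtain k where k: "k \<in> I - {x}" "Re (z k) > 0" using z by (auto simp: right_half_plane_point_def)
    show "y \<bullet> (realification U *v y) > 0"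
      unfolding form
    proof (rule sum_pos2[of I k])
      show "Re (z i) * (y \<bullet> (realification (B i) *v y)) \<ge> 0" if "i \<in> I" for i
        using z pos[of i] that by (cases "i = x") (auto simp: right_half_plane_point_def less_imp_le)
    qed (use I k pos in auto)
  qed
  ultimately show ?thesis by auto
qed

section \<open>The Alexandrov inequality\<close>

lemma mixed_discriminant_add_pair:
  fixes A :: "nat \<Rightarrow> quat^'n^'n"
  assumes jk: "j \<in> {1..CARD('n)}" "k \<in> {1..CARD('n)}" "j \<noteq> k"
    and A: "\<forall>i\<in>{1..CARD('n)}. i \<noteq> j \<longrightarrow> i \<noteq> k \<longrightarrow> hyperhermitian (A i)"
    and CX: "hyperhermitian C" "hyperhermitian X"
  shows "mixed_discriminant (A(j := C + t *\<^sub>R X, k := C + t *\<^sub>R X)) = mixed_discriminant (A(j := C, k := C))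
    + 2 * t * mixed_discriminant (A(j := C, k := X)) + t\<^sup>2 * mixed_discriminant (A(j := X, k := X))"
proof -
  have k_lin: "mixed_discriminant (A(j := Z, k := C + t *\<^sub>R X)) =
      mixed_discriminant (A(j := Z, k := C)) + t * mixed_discriminant (A(j := Z, k := X))"
    if "hyperhermitian Z" for Z
    using mixed_discriminant_linear[of k "A(j := Z)" C X 1 t] jk A CX that by auto
  have j_lin: "mixed_discriminant (A(j := C + t *\<^sub>R X, k := Z)) =
      mixed_discriminant (A(j := C, k := Z)) + t * mixed_discriminant (A(j := X, k := Z))"
    if "hyperhermitian Z" for Z
    using mixed_discriminant_linear[of j "A(k := Z)" C X 1 t] jk A CX that by (auto simp: fun_upd_twist)
  have "mixed_discriminant (A(j := X, k := C)) = mixed_discriminant (A(j := C, k := X))"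
    by (rule mixed_discriminant_swap[OF A CX(2,1) jk])
  then show ?thesis
    using CX by (simp add: k_lin j_lin hyperhermitian_add hyperhermitian_scaleR algebra_simps power2_eq_square)
qed

text \<open>
  A negative discriminant would give the quadratic polynomial two nonreal conjugate zeros, and
  multiplication by \<open>i\<close> moves one of them into the right half plane.
\<close>
lemma discriminant_nonneg_if_no_right_half_plane_zero:
  fixes a b c :: real
  assumes "\<And>z. Re z > 0 \<Longrightarrow> of_real a * z\<^sup>2 + of_real b * \<i> * z - of_real c \<noteq> 0" and a: "a \<noteq> 0"
  shows "4 * a * c \<le> b\<^sup>2"
proof (rule ccontr)
  assume "\<not> 4 * a * c \<le> b\<^sup>2"
  then have pos: "4 * a * c - b\<^sup>2 > 0" by simp
  \<comment> \<open>Real part of the zero; the absolute value selects the zero in the right half plane.\<close>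
  define r where "r = sqrt (4 * a * c - b\<^sup>2) / (2 * \<bar>a\<bar>)"
  have r: "r > 0" using pos a by (simp add: r_def)
  have r2: "4 * a\<^sup>2 * r\<^sup>2 = 4 * a * c - b\<^sup>2"
    using pos a by (simp add: r_def power_divide power_mult_distrib)
  define q where "q = b / (2 * a)"
  have b: "b = 2 * a * q" using a by (simp add: q_def)
  define z where "z = Complex r (- q)"
  have "of_real a * z\<^sup>2 + of_real b * \<i> * z - of_real c = 0"
  proof -
    have "4 * a * (a * (r\<^sup>2 - q\<^sup>2) + b * q - c) = 0"
      using r2 by (simp add: b power2_eq_square algebra_simps)
    then have "a * (r\<^sup>2 - q\<^sup>2) + b * q - c = 0" using a by simp
    then show ?thesis
      by (simp add: z_def complex_eq_iff power2_eq_square b algebra_simps)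
  qed
  moreover have "Re z > 0" using r by (simp add: z_def)
  ultimately show False using assms(1) by blast
qed

definition positive_definite_except :: "nat \<Rightarrow> nat \<Rightarrow> (nat \<Rightarrow> quat^'n^'n) \<Rightarrow> bool" where
  "positive_definite_except j k A \<longleftrightarrow>
     (\<forall>i\<in>{1..CARD('n)}. i \<noteq> j \<longrightarrow> i \<noteq> k \<longrightarrow> hyperhermitian (A i) \<and> positive_definite (A i))"

text \<open>
  The quadratic form \<open>Y \<mapsto> D(.., Y, Y)\<close> is Lorentzian up to sign, with every positive definite \<open>C\<close>
  being anisotropic.  The numbers \<open>a\<close>, \<open>b\<close>, \<open>c\<close> are the coefficients of
  \<open>D(.., z C + w X, z C + w X)\<close> up to the factor \<open>2 / n!\<close>.
\<close>
theorem mixed_discriminant_hyperbolic: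
  fixes A :: "nat \<Rightarrow> quat^'n^'n"
  assumes jk: "j \<in> {1..CARD('n)}" "k \<in> {1..CARD('n)}" "j \<noteq> k"
    and A: "positive_definite_except j k A"
    and C: "hyperhermitian C" "positive_definite C" and X: "hyperhermitian X"
  shows "mixed_discriminant (A(j := C, k := C)) \<noteq> 0"
    and "mixed_discriminant (A(j := C, k := C)) * mixed_discriminant (A(j := X, k := X))
      \<le> (mixed_discriminant (A(j := C, k := X)))\<^sup>2"
proof -
  let ?I = "{1..CARD('n)}"
  let ?B = "A(j := C, k := X)" and ?K = "?I - {j, k}"
  have A': "\<forall>i\<in>?I. i \<noteq> j \<longrightarrow> i \<noteq> k \<longrightarrow> hyperhermitian (A i)" using A by (simp add: positive_definite_except_def)
  have B: "\<forall>i\<in>?I. hyperhermitian (?B i)" "\<forall>i\<in>?I - {k}. positive_definite (?B i)"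
    using A C X by (auto simp: positive_definite_except_def)
  obtain p where keys: "\<forall>m\<in>Poly_Mapping.keys p. Poly_Mapping.keys m \<subseteq> ?I"
    and deg: "\<forall>m\<in>Poly_Mapping.keys p. (\<Sum>i\<in>?I. Poly_Mapping.lookup m i) = CARD('n)"
    and eval: "\<forall>l. mpoly_eval p l = moore_det (\<Sum>i\<in>?I. l i *\<^sub>R ?B i)"
    by (rule moore_det_mpoly[of ?I ?B]) (use B in auto)
  define M where "M = {m \<in> Poly_Mapping.keys p. \<forall>i\<in>?K. Poly_Mapping.lookup m i = 1}"
  define a where "a = (\<Sum>m\<in>M. Poly_Mapping.lookup p m * of_bool (Poly_Mapping.lookup m k = 0))"
  define c where "c = (\<Sum>m\<in>M. Poly_Mapping.lookup p m * of_bool (Poly_Mapping.lookup m j = 0))"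
  define b where "b = (\<Sum>m\<in>M. Poly_Mapping.lookup p m * of_bool (Poly_Mapping.lookup m j = 1))"
  have cases: "Poly_Mapping.lookup m j = 2 \<and> Poly_Mapping.lookup m k = 0 \<or>
     Poly_Mapping.lookup m j = 1 \<and> Poly_Mapping.lookup m k = 1 \<or>
     Poly_Mapping.lookup m j = 0 \<and> Poly_Mapping.lookup m k = 2" if m: "m \<in> M" for m
  proof -
    have "?I = insert j (insert k ?K)" using jk by auto
    then have "(\<Sum>i\<in>?I. Poly_Mapping.lookup m i) = (\<Sum>i\<in>insert j (insert k ?K). Poly_Mapping.lookup m i)"
      and card: "card ?I = card (insert j (insert k ?K))" by simp_all
    then have "(\<Sum>i\<in>?I. Poly_Mapping.lookup m i) = Poly_Mapping.lookup m j + Poly_Mapping.lookup m k + card ?K"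
      using jk(3) m by (simp add: M_def)
    moreover have "card ?I = card ?K + 2" unfolding card using jk(3) by simp
    ultimately have "Poly_Mapping.lookup m j + Poly_Mapping.lookup m k = 2"
      using deg m by (simp add: M_def)
    then show ?thesis by linarith
  qed
  have quadratic: "(\<Sum>m\<in>M. of_real (Poly_Mapping.lookup p m) * (z ^ Poly_Mapping.lookup m j * w ^ Poly_Mapping.lookup m k))
      = of_real a * z\<^sup>2 + of_real b * (z * w) + of_real c * w\<^sup>2" for z w :: "'a::{real_algebra_1,comm_ring_1}"
    unfolding a_def b_def c_def of_real_sum sum_distrib_right sum.distrib[symmetric]
  proof (intro sum.cong refl)
    fix m assume "m \<in> M"
    from cases[OF this] show "of_real (Poly_Mapping.lookup p m) * (z ^ Poly_Mapping.lookup m j * w ^ Poly_Mapping.lookup m k) =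
      of_real (Poly_Mapping.lookup p m * of_bool (Poly_Mapping.lookup m k = 0)) * z\<^sup>2 +
      of_real (Poly_Mapping.lookup p m * of_bool (Poly_Mapping.lookup m j = 1)) * (z * w) +
      of_real (Poly_Mapping.lookup p m * of_bool (Poly_Mapping.lookup m j = 0)) * w\<^sup>2"
      by (elim disjE conjE) (simp_all add: power2_eq_square)
  qed
  have md: "fact CARD('n) * mixed_discriminant (A(j := z *\<^sub>R C + w *\<^sub>R X, k := z *\<^sub>R C + w *\<^sub>R X)) =
      2 * (a * z\<^sup>2 + b * (z * w) + c * w\<^sup>2)" for z w
    using mixed_discriminant_equal_pair[OF jk A' C(1) X keys deg eval, of z w] quadratic[of z w]
    by (simp add: M_def)
  have CC: "fact CARD('n) * mixed_discriminant (A(j := C, k := C)) = 2 * a" using md[of 1 0] by simp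
  have XX: "fact CARD('n) * mixed_discriminant (A(j := X, k := X)) = 2 * c" using md[of 0 1] by simp
  have CX: "fact CARD('n) * mixed_discriminant (A(j := C, k := X)) = b"
    using md[of 1 1] mixed_discriminant_add_pair[OF jk A' C(1) X, of 1] CC XX by (simp add: algebra_simps)
  have nonzero: "of_real a * z\<^sup>2 + of_real b * (z * w) + of_real c * w\<^sup>2 \<noteq> 0"
    if "Re z > 0" "Re w = 0" for z w :: complex
  proof -
    let ?z = "\<lambda>i. if i = j then z else w"
    have "?I - ?K = {j, k}" "?K \<subset> ?I - {k}" using jk by blast+
    moreover have "right_half_plane_point (?I - {k} - ?K) k ?z"
      using jk that by (auto simp: right_half_plane_point_def)
    moreover have base: "\<forall>z. right_half_plane_point (?I - {k}) k z \<longrightarrow> multilinear_part ?I {} p z \<noteq> 0"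
      using mpoly_nonzero_right_half_plane[OF _ jk(2) keys eval B] by blast
    ultimately have "multilinear_part ?I ?K p ?z \<noteq> 0"
      using jk deg by (intro multilinear_part_nonzero[of ?I k]) auto
    moreover have "multilinear_part ?I ?K p ?z = of_real a * z\<^sup>2 + of_real b * (z * w) + of_real c * w\<^sup>2"
      unfolding quadratic[symmetric] multilinear_part_def M_def \<open>?I - ?K = {j, k}\<close>
      using jk(3) by simp
    ultimately show ?thesis by simp
  qed
  have a: "a \<noteq> 0" using nonzero[of 1 0] by simp
  then show "mixed_discriminant (A(j := C, k := C)) \<noteq> 0" using CC by auto
  have "4 * a * c \<le> b\<^sup>2"
    by (rule discriminant_nonneg_if_no_right_half_plane_zero)
      (use nonzero[of _ \<i>] a in \<open>auto simp: mult_ac\<close>)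
  have "(fact CARD('n))\<^sup>2 * (mixed_discriminant (A(j := C, k := C)) * mixed_discriminant (A(j := X, k := X)))
      = (fact CARD('n) * mixed_discriminant (A(j := C, k := C))) * (fact CARD('n) * mixed_discriminant (A(j := X, k := X)))"
    by (simp add: power2_eq_square mult_ac)
  also have "\<dots> = 4 * a * c" unfolding CC XX by simp
  also have "\<dots> \<le> b\<^sup>2" by fact
  also have "\<dots> = (fact CARD('n))\<^sup>2 * (mixed_discriminant (A(j := C, k := X)))\<^sup>2"
    unfolding CX[symmetric] by (rule power_mult_distrib)
  finally show "mixed_discriminant (A(j := C, k := C)) * mixed_discriminant (A(j := X, k := X))
      \<le> (mixed_discriminant (A(j := C, k := X)))\<^sup>2"
    by (subst (asm) mult_le_cancel_left_pos) simp_all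
qed

section \<open>Nondegeneracy and the equality case\<close>

lemma mixed_discriminant_cong:
  fixes A :: "nat \<Rightarrow> quat^'n^'n"
  assumes "\<And>i. i \<in> {1..CARD('n)} \<Longrightarrow> A i = B i"
  shows "mixed_discriminant A = mixed_discriminant B"
proof -
  have "(\<Sum>i=1..CARD('n). l i *\<^sub>R A i) = (\<Sum>i=1..CARD('n). l i *\<^sub>R B i)" for l
    using assms by (intro sum.cong) auto
  then show ?thesis by (simp only: mixed_discriminant_def)
qed

lemma positive_definite_perturb:
  fixes A H :: "quat^'n^'n"
  assumes A: "hyperhermitian A" "positive_definite A" and H: "hyperhermitian H"
  obtains e where "e > 0" "\<And>t. \<bar>t\<bar> \<le> e \<Longrightarrow> positive_definite (A + t *\<^sub>R H)"
proof -
  let ?S = "sphere (0 :: real^('n \<times> 4)) 1"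
  let ?f = "\<lambda>M y :: real^('n \<times> 4). y \<bullet> (realification M *v y)"
  have cont: "continuous_on ?S (?f M)" for M
    by (intro continuous_intros linear_continuous_on matrix_vector_mul_bounded_linear)
  have ne: "?S \<noteq> {}" by (simp add: sphere_eq_empty)
  obtain y0 where y0: "y0 \<in> ?S" "\<forall>y\<in>?S. ?f A y0 \<le> ?f A y"
    using continuous_attains_inf[OF compact_sphere ne cont] by blast
  have "compact (?f H ` ?S)" by (rule compact_continuous_image[OF cont compact_sphere])
  then have "bounded (?f H ` ?S)" by (rule compact_imp_bounded)
  then obtain K where "\<forall>v\<in>?f H ` ?S. \<bar>v\<bar> \<le> K" unfolding bounded_real by blast
  then have K: "\<bar>?f H y\<bar> \<le> K" if "y \<in> ?S" for y using that by blast
  have "y0 \<noteq> 0" using y0(1) by auto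
  then have c: "?f A y0 > 0" by (rule positive_definite_realification[OF A(2)])
  have K0: "K \<ge> 0" using K[OF y0(1)] by linarith
  define e where "e = ?f A y0 / (K + 1)"
  have e: "e > 0" using c K0 by (simp add: e_def)
  show ?thesis
  proof (rule that[OF e])
    fix t :: real assume t: "\<bar>t\<bar> \<le> e"
    have sphere: "?f (A + t *\<^sub>R H) y > 0" if y: "y \<in> ?S" for y
    proof -
      have "\<bar>t * ?f H y\<bar> \<le> e * K"
        unfolding abs_mult using t K[OF y] e by (intro mult_mono) auto
      also have "e * K < ?f A y0" using c K0 by (simp add: e_def pos_divide_less_eq field_simps)
      also have "\<dots> \<le> ?f A y" using y0(2) y by blast
      finally have "?f A y + t * ?f H y > 0" by linarith
      then show ?thesis
        by (simp add: realification_add realification_scaleR matrix_vector_mult_add_rdistrib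
            inner_add_right flip: scaleR_matrix_vector_assoc)
    qed
    have "?f (A + t *\<^sub>R H) y > 0" if "y \<noteq> 0" for y
    proof -
      have "y /\<^sub>R norm y \<in> ?S" using that by simp
      from sphere[OF this] have "?f (A + t *\<^sub>R H) y / (norm y * norm y) > 0"
        by (simp add: matrix_vector_mult_scaleR divide_inverse mult_ac)
      then show ?thesis using that by (simp add: zero_less_divide_iff)
    qed
    then show "positive_definite (A + t *\<^sub>R H)"
      using positive_definite_iff[of "A + t *\<^sub>R H"] A(1) H
      by (simp add: hyperhermitian_add hyperhermitian_scaleR)
  qed
qed

lemma nonpos_if_le_small_multiples:
  fixes c K :: real
  assumes "e > 0" "\<And>t. 0 < t \<Longrightarrow> t \<le> e \<Longrightarrow> c \<le> t * K"
  shows "c \<le> 0"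
proof (rule ccontr)
  assume c: "\<not> c \<le> 0"
  define t where "t = min e (c / (2 * (\<bar>K\<bar> + 1)))"
  have t: "0 < t" "t \<le> e" using c assms(1) by (auto simp: t_def)
  have "t * K \<le> t * (\<bar>K\<bar> + 1)" using t by (intro mult_left_mono) auto
  also have "\<dots> \<le> c / (2 * (\<bar>K\<bar> + 1)) * (\<bar>K\<bar> + 1)" by (intro mult_right_mono) (auto simp: t_def)
  also have "\<dots> = c / 2" by (simp add: field_simps)
  finally show False using assms(2)[OF t] c by simp
qed

text \<open>
  On the orthogonal complement of \<open>C\<close> the form is semidefinite, and an isotropic vector of a
  semidefinite form lies in its kernel: otherwise the value at \<open>Y' + t X\<close>, which is affine in \<open>t\<close>,
  would take both signs.  Here \<open>Y'\<close> is the projection of \<open>Y\<close> to that complement.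
\<close>
lemma mixed_discriminant_kernel:
  fixes A :: "nat \<Rightarrow> quat^'n^'n"
  assumes jk: "j \<in> {1..CARD('n)}" "k \<in> {1..CARD('n)}" "j \<noteq> k"
    and A: "positive_definite_except j k A"
    and C: "hyperhermitian C" "positive_definite C"
    and X: "hyperhermitian X" "mixed_discriminant (A(j := C, k := X)) = 0"
      "mixed_discriminant (A(j := X, k := X)) = 0"
    and Y: "hyperhermitian Y"
  shows "mixed_discriminant (A(j := X, k := Y)) = 0"
proof -
  let ?b = "\<lambda>X Y. mixed_discriminant (A(j := X, k := Y))"
  have A': "\<forall>i\<in>{1..CARD('n)}. i \<noteq> j \<longrightarrow> i \<noteq> k \<longrightarrow> hyperhermitian (A i)"
    using A by (simp add: positive_definite_except_def)
  note hyperbolic = mixed_discriminant_hyperbolic[OF jk A C]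
  have lin: "?b Z (P + r *\<^sub>R Q) = ?b Z P + r * ?b Z Q"
    if "hyperhermitian Z" "hyperhermitian P" "hyperhermitian Q" for Z P Q r
    using mixed_discriminant_linear[of k "A(j := Z)" P Q 1 r] jk A' that by auto
  have CC: "?b C C \<noteq> 0" using hyperbolic(1)[OF X(1)] .
  define Y' where "Y' = Y + (- (?b C Y / ?b C C)) *\<^sub>R C"
  have Y': "hyperhermitian Y'" unfolding Y'_def using Y C by (intro hyperhermitian_add hyperhermitian_scaleR)
  have CY': "?b C Y' = 0"
    unfolding Y'_def lin[OF C(1) Y C(1)] using CC by simp
  have neg: "?b C C * (?b Y' Y' + 2 * t * ?b Y' X) \<le> 0" for t
  proof -
    have "?b C (Y' + t *\<^sub>R X) = 0" using lin[OF C(1) Y' X(1)] CY' X(2) by simp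
    then have "?b C C * ?b (Y' + t *\<^sub>R X) (Y' + t *\<^sub>R X) \<le> 0"
      using hyperbolic(2)[of "Y' + t *\<^sub>R X"] Y' X(1) by (simp add: hyperhermitian_add hyperhermitian_scaleR)
    then show ?thesis
      using mixed_discriminant_add_pair[OF jk A' Y' X(1), of t] X(3) by simp
  qed
  have "?b Y' X = 0"
  proof (rule ccontr)
    assume b: "?b Y' X \<noteq> 0"
    define t where "t = (1 - ?b C C * ?b Y' Y') / (2 * (?b C C * ?b Y' X))"
    have "?b C C * (?b Y' Y' + 2 * t * ?b Y' X) = ?b C C * ?b Y' Y' + t * (2 * (?b C C * ?b Y' X))"
      by (simp add: algebra_simps)
    also have "\<dots> = 1" using b CC by (simp add: t_def)
    finally show False using neg[of t] by simp
  qed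
  then have "?b X Y' = 0" using mixed_discriminant_swap[OF A' Y' X(1) jk] by simp
  moreover have "?b X C = 0" using mixed_discriminant_swap[OF A' X(1) C(1) jk] X(2) by simp
  moreover have "?b X Y' = ?b X Y + (- (?b C Y / ?b C C)) * ?b X C"
    unfolding Y'_def by (rule lin[OF X(1) Y C(1)])
  ultimately show ?thesis by simp
qed

text \<open>
  Write \<open>T(P, Q, R)\<close> for the mixed discriminant with \<open>P\<close>, \<open>Q\<close>, \<open>R\<close> at the slots \<open>i\<close>, \<open>j\<close>, \<open>k\<close>, and \<open>E\<close>
  for the original entry at \<open>i\<close>.  For small \<open>t\<close> of either sign \<open>E + t C\<close> is positive definite.  In the
  inequality for this entry the left-hand side is of first order in \<open>t\<close>, with coefficient
  \<open>T(E, E, E) T(C, X, X)\<close>, and the right-hand side is of second order.  Hence \<open>T(C, X, X) = 0\<close>.  Since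
  \<open>T(C, E, X) = T(E, X, C) = 0\<close> by symmetry, \<open>X\<close> is isotropic and orthogonal to \<open>E\<close> also after the
  replacement.
\<close>
lemma mixed_discriminant_kernel_replace:
  fixes A :: "nat \<Rightarrow> quat^'n^'n"
  assumes jk: "j \<in> {1..CARD('n)}" "k \<in> {1..CARD('n)}" "j \<noteq> k"
    and i: "i \<in> {1..CARD('n)}" "i \<noteq> j" "i \<noteq> k"
    and A: "positive_definite_except j k A"
    and C: "hyperhermitian C" "positive_definite C"
    and X: "hyperhermitian X"
    and ker: "\<forall>Y. hyperhermitian Y \<longrightarrow> mixed_discriminant (A(j := X, k := Y)) = 0"
  shows "\<forall>Y. hyperhermitian Y \<longrightarrow> mixed_discriminant (A(i := C, j := X, k := Y)) = 0"
proof -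
  define T where "T = (\<lambda>P Q R. mixed_discriminant (A(i := P, j := Q, k := R)))"
  define E where "E = A i"
  have A': "hyperhermitian (A l)" if "l \<in> {1..CARD('n)}" "l \<noteq> j" "l \<noteq> k" for l
    using A that by (simp add: positive_definite_except_def)
  have E: "hyperhermitian E" "positive_definite E"
    using A i by (auto simp: E_def positive_definite_except_def)
  have lin: "T (P + r *\<^sub>R Q) U V = T P U V + r * T Q U V"
    if "hyperhermitian P" "hyperhermitian Q" "hyperhermitian U" "hyperhermitian V" for P Q U V r
    using mixed_discriminant_linear[of i "A(j := U, k := V)" P Q 1 r] i jk A' that
    by (auto simp: T_def fun_upd_twist[of i j] fun_upd_twist[of i k])
  have swap_jk: "T P U V = T P V U"
    if "hyperhermitian P" "hyperhermitian U" "hyperhermitian V" for P U V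
    using mixed_discriminant_swap[of j k "A(i := P)" U V] jk i A' that by (auto simp: T_def)
  have swap_ij: "T P U V = T U P V"
    if "hyperhermitian P" "hyperhermitian U" "hyperhermitian V" for P U V
    using mixed_discriminant_swap[of i j "A(k := V)" P U] jk i A' that
    by (auto simp: T_def fun_upd_twist[of k i] fun_upd_twist[of k j])
  have ker_E: "T E X Y = 0" if "hyperhermitian Y" for Y
    using ker that by (simp add: T_def E_def)
  have pos: "positive_definite_except j k (A(i := P))" if "hyperhermitian P" "positive_definite P" for P
    using A that by (auto simp: positive_definite_except_def)
  have CXX: "T C X X = 0"
  proof -
    obtain e where e: "e > 0" "\<And>t. \<bar>t\<bar> \<le> e \<Longrightarrow> positive_definite (E + t *\<^sub>R C)"
      using positive_definite_perturb[OF E C(1)] by blast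
    define K where "K = (T C E X)\<^sup>2 - T C E E * T C X X"
    have ineq: "t * (T E E E * T C X X) \<le> t\<^sup>2 * K" if "\<bar>t\<bar> \<le> e" for t
    proof -
      have hyp: "hyperhermitian (E + t *\<^sub>R C)" using E C by (simp add: hyperhermitian_add hyperhermitian_scaleR)
      have "T (E + t *\<^sub>R C) E E * T (E + t *\<^sub>R C) X X \<le> (T (E + t *\<^sub>R C) E X)\<^sup>2"
        using mixed_discriminant_hyperbolic(2)[OF jk pos[OF hyp e(2)[OF that]] E X]
        by (simp add: T_def)
      moreover have "T E E X = 0" using ker_E[OF E(1)] swap_jk[of E E X] E X by simp
      ultimately have "(T E E E + t * T C E E) * (t * T C X X) \<le> (t * T C E X)\<^sup>2"
        using ker_E[OF X] E C X by (simp add: lin)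
      then show ?thesis by (simp add: K_def power2_eq_square algebra_simps)
    qed
    have "T E E E * T C X X \<le> 0"
    proof (rule nonpos_if_le_small_multiples[OF e(1)])
      fix t :: real assume t: "0 < t" "t \<le> e"
      have "t * (T E E E * T C X X) \<le> t * (t * K)"
        using ineq[of t] t by (simp add: power2_eq_square mult.assoc)
      then show "T E E E * T C X X \<le> t * K" using t(1) by simp
    qed
    moreover have "- (T E E E * T C X X) \<le> 0"
    proof (rule nonpos_if_le_small_multiples[OF e(1)])
      fix t :: real assume t: "0 < t" "t \<le> e"
      have "t * - (T E E E * T C X X) \<le> t * (t * K)"
        using ineq[of "- t"] t by (simp add: power2_eq_square mult.assoc)
      then show "- (T E E E * T C X X) \<le> t * K" using t(1) by (simp only: mult_le_cancel_left_pos)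
    qed
    moreover have "T E E E \<noteq> 0"
      using mixed_discriminant_hyperbolic(1)[OF jk pos[OF E] E E(1)] by (simp add: T_def)
    ultimately show ?thesis by simp
  qed
  have "T C E X = T E X C" using swap_ij[of C E X] swap_jk[of E C X] E C X by simp
  also have "\<dots> = 0" using ker_E[OF C(1)] .
  finally have "T C E X = 0" .
  then show ?thesis
    using mixed_discriminant_kernel[OF jk pos[OF C] E X] CXX by (simp add: T_def)
qed

lemma mixed_discriminant_kernel_all:
  fixes A B :: "nat \<Rightarrow> quat^'n^'n"
  assumes jk: "j \<in> {1..CARD('n)}" "k \<in> {1..CARD('n)}" "j \<noteq> k"
    and A: "positive_definite_except j k A" and B: "positive_definite_except j k B"
    and X: "hyperhermitian X"
    and ker: "\<forall>Y. hyperhermitian Y \<longrightarrow> mixed_discriminant (A(j := X, k := Y)) = 0"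
    and Y: "hyperhermitian Y"
  shows "mixed_discriminant (B(j := X, k := Y)) = 0"
proof -
  define F where "F = (\<lambda>S i. if i \<in> S then B i else A i)"
  have step: "\<forall>Y. hyperhermitian Y \<longrightarrow> mixed_discriminant ((F S)(j := X, k := Y)) = 0"
    if "finite S" "S \<subseteq> {1..CARD('n)} - {j, k}" for S
    using that
  proof (induction S)
    case empty
    have "F {} = A" by (simp add: F_def)
    then show ?case using ker by (simp only:)
  next
    case (insert i S)
    have F_insert: "(F S)(i := B i) = F (insert i S)" by (auto simp: F_def)
    have F_pos: "positive_definite_except j k (F S)" using A B by (auto simp: F_def positive_definite_except_def)
    have i: "i \<in> {1..CARD('n)}" "i \<noteq> j" "i \<noteq> k" using insert.prems by auto
    then have B_i: "hyperhermitian (B i)" "positive_definite (B i)"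
      using B by (auto simp: positive_definite_except_def)
    have IH: "\<forall>Y. hyperhermitian Y \<longrightarrow> mixed_discriminant ((F S)(j := X, k := Y)) = 0"
      using insert by blast
    from mixed_discriminant_kernel_replace[OF jk i F_pos B_i X IH] show ?case
      unfolding F_insert .
  qed
  have fin: "finite ({1..CARD('n)} - {j, k})" by simp
  from step[OF fin order_refl, rule_format, OF Y]
  have "mixed_discriminant ((F ({1..CARD('n)} - {j, k}))(j := X, k := Y)) = 0" .
  moreover have "mixed_discriminant ((F ({1..CARD('n)} - {j, k}))(j := X, k := Y)) = mixed_discriminant (B(j := X, k := Y))"
    by (rule mixed_discriminant_cong) (auto simp: F_def)
  ultimately show ?thesis by simp
qed

lemma moore_det_scaleR:
  fixes A :: "quat^'n^'n"
  assumes A: "hyperhermitian A"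
  shows "moore_det (r *\<^sub>R A) = r ^ CARD('n) * moore_det A"
proof -
  obtain p where p: "\<forall>m\<in>Poly_Mapping.keys p. Poly_Mapping.keys m \<subseteq> {0}"
    "\<forall>m\<in>Poly_Mapping.keys p. (\<Sum>i\<in>{0}. Poly_Mapping.lookup m i) = CARD('n)"
    "\<forall>l. mpoly_eval p l = moore_det (\<Sum>i\<in>{0}. l i *\<^sub>R A)"
    by (rule moore_det_mpoly[of "{0}" "\<lambda>_. A"]) (use A in auto)
  have "moore_det (s *\<^sub>R A) = (\<Sum>m\<in>Poly_Mapping.keys p. Poly_Mapping.lookup p m * s ^ CARD('n))" for s
  proof -
    have "monomial_eval (\<lambda>_. s) m = s ^ CARD('n)" if "m \<in> Poly_Mapping.keys p" for m
      using p(1,2) that by (simp add: monomial_eval_superset[of "{0}"])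
    then show ?thesis
      using p(3)[rule_format, of "\<lambda>_. s"] by (simp add: mpoly_eval_superset[of "Poly_Mapping.keys p"])
  qed
  from this[of r] this[of 1] show ?thesis by (simp add: sum_distrib_left mult.commute)
qed

text \<open>
  By homogeneity the subset \<open>S\<close> contributes \<open>card S ^ n\<close> times the Moore determinant of \<open>A\<close> to the
  alternating sum.
\<close>
lemma mixed_discriminant_constant_family:
  "\<exists>c. \<forall>A :: quat^'n^'n. hyperhermitian A \<longrightarrow> mixed_discriminant (\<lambda>_. A) = c * moore_det A"
proof (intro exI allI impI)
  fix A :: "quat^'n^'n" assume A: "hyperhermitian A"
  let ?I = "{1..CARD('n)}"
  have "moore_det (\<Sum>i\<in>S. A) = real (card S) ^ CARD('n) * moore_det A" for S :: "nat set"
    using moore_det_scaleR[OF A, of "real (card S)"] by (simp add: sum_constant_scaleR del: sum_constant)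
  then have "fact CARD('n) * mixed_discriminant (\<lambda>_. A) =
      (\<Sum>S\<in>Pow ?I. (-1) ^ card (?I - S) * real (card S) ^ CARD('n)) * moore_det A"
    using mixed_discriminant_alternating_sum[of "\<lambda>_. A"] A by (simp add: sum_distrib_right mult.assoc)
  then show "mixed_discriminant (\<lambda>_. A) =
      (\<Sum>S\<in>Pow ?I. (-1) ^ card (?I - S) * real (card S) ^ CARD('n)) / fact CARD('n) * moore_det A"
    by (simp add: field_simps)
qed

text \<open>
  Maximize the quadratic form on the unit sphere, after changing the sign of \<open>M\<close> if necessary so that
  the form takes a positive value.  At a maximizer \<open>u\<close> with value \<open>\<mu>\<close> the form \<open>\<mu> |y|\<^sup>2 - y \<bullet> M y\<close> is
  minimal, so its derivative vanishes there.
\<close>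
lemma symmetric_matrix_eigenvector:
  fixes M :: "real^'m^'m"
  assumes sym: "transpose M = M" and "M \<noteq> 0"
  obtains x \<mu> where "x \<noteq> 0" "\<mu> \<noteq> 0" "M *v x = \<mu> *\<^sub>R x"
proof -
  have max: "\<exists>x \<mu>. x \<noteq> 0 \<and> \<mu> \<noteq> 0 \<and> N *v x = \<mu> *\<^sub>R x"
    if sym: "transpose N = N" and z: "z \<bullet> (N *v z) > 0" for N :: "real^'m^'m" and z
  proof -
    let ?S = "sphere (0 :: real^'m) 1" and ?f = "\<lambda>y. y \<bullet> (N *v y)"
    have z0: "z \<noteq> 0" using z by auto
    then have zS: "z /\<^sub>R norm z \<in> ?S" by simp
    have cont: "continuous_on ?S ?f"
      by (intro continuous_intros linear_continuous_on matrix_vector_mul_bounded_linear)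
    obtain u where u: "u \<in> ?S" "\<forall>y\<in>?S. ?f y \<le> ?f u"
      using continuous_attains_sup[OF compact_sphere _ cont] zS by blast
    define \<mu> where "\<mu> = ?f u"
    have scale: "?f (y /\<^sub>R norm y) = ?f y / (norm y * norm y)" for y
      by (simp add: matrix_vector_mult_scaleR divide_inverse mult_ac)
    have "0 < ?f (z /\<^sub>R norm z)" unfolding scale using z z0 by simp
    then have \<mu>: "\<mu> > 0" using u(2) zS unfolding \<mu>_def by (meson less_le_trans)
    have bound: "?f y \<le> \<mu> * (y \<bullet> y)" for y
    proof (cases "y = 0")
      case False
      then have "y /\<^sub>R norm y \<in> ?S" by simp
      then have "?f y / (norm y * norm y) \<le> \<mu>"
        using u(2) unfolding \<mu>_def scale[symmetric] by blast
      then show ?thesis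
        using False by (simp add: pos_divide_le_eq dot_square_norm power2_eq_square)
    qed simp
    have uu: "u \<bullet> u = 1" using u(1) by (simp add: dot_square_norm)
    define d where "d = \<mu> *\<^sub>R u - N *v u"
    \<comment> \<open>Second-order expansion at \<open>u\<close>; moving against the residual \<open>d\<close> would decrease the form.\<close>
    have expand: "\<mu> * ((u + t *\<^sub>R y) \<bullet> (u + t *\<^sub>R y)) - ?f (u + t *\<^sub>R y)
        = 2 * t * (y \<bullet> d) + t\<^sup>2 * (\<mu> * (y \<bullet> y) - ?f y)" for t y
      using symmetric_form[OF sym, of u y] uu
      by (simp add: d_def \<mu>_def[symmetric] matrix_vector_right_distrib matrix_vector_mult_scaleR
          inner_add_left inner_add_right inner_diff_right inner_commute[of u y] power2_eq_square algebra_simps)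
    have "2 * (d \<bullet> d) \<le> 0"
    proof (rule nonpos_if_le_small_multiples[of 1])
      fix t :: real assume t: "0 < t"
      have "0 \<le> 2 * (- t) * (d \<bullet> d) + (- t)\<^sup>2 * (\<mu> * (d \<bullet> d) - ?f d)"
        using bound[of "u + (- t) *\<^sub>R d"] expand[of "- t" d] by linarith
      then have "t * (2 * (d \<bullet> d)) \<le> t * (t * (\<mu> * (d \<bullet> d) - ?f d))"
        by (simp add: power2_eq_square mult_ac)
      then show "2 * (d \<bullet> d) \<le> t * (\<mu> * (d \<bullet> d) - ?f d)" using t by (simp only: mult_le_cancel_left_pos)
    qed simp
    then have "d = 0" by (metis inner_ge_zero inner_eq_zero_iff mult_le_0_iff not_less order_antisym zero_less_numeral)
    moreover have "u \<noteq> 0" using uu by auto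
    ultimately show ?thesis using \<mu> by (intro exI[of _ u] exI[of _ \<mu>]) (auto simp: d_def)
  qed
  have "\<exists>z. z \<bullet> (M *v z) \<noteq> 0"
  proof (rule ccontr)
    assume "\<not> ?thesis"
    then have 0: "z \<bullet> (M *v z) = 0" for z by blast
    have "x \<bullet> (M *v y) = 0" for x y
      using 0[of "x + y"] 0[of x] 0[of y] symmetric_form[OF sym, of x y]
      by (simp add: matrix_vector_right_distrib inner_add_left inner_add_right)
    then have "M *v y = 0" for y by (metis inner_eq_zero_iff)
    then have "M = 0" by (simp add: matrix_eq)
    with \<open>M \<noteq> 0\<close> show False by simp
  qed
  then obtain z where "z \<bullet> (M *v z) \<noteq> 0" by blast
  have minus: "(- M) *v y = - (M *v y)" for y
    by (simp add: vec_eq_iff matrix_vector_mult_def sum_negf)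
  from \<open>z \<bullet> (M *v z) \<noteq> 0\<close> consider "z \<bullet> (M *v z) > 0" | "z \<bullet> ((- M) *v z) > 0"
    unfolding minus inner_minus_right by linarith
  then show thesis
  proof cases
    case 1
    then show thesis using max[OF sym] that by blast
  next
    case 2
    have "transpose (- M) = - M" using sym by (simp add: transpose_def vec_eq_iff)
    then obtain x \<mu> where "x \<noteq> 0" "\<mu> \<noteq> 0" "(- M) *v x = \<mu> *\<^sub>R x" using max[OF _ 2] by blast
    then have "M *v x = (- \<mu>) *\<^sub>R x" unfolding minus by (metis minus_minus scaleR_minus_left)
    then show thesis using that[of x "- \<mu>"] \<open>x \<noteq> 0\<close> \<open>\<mu> \<noteq> 0\<close> by simp
  qed
qed

text \<open>
  An eigenvalue \<open>\<mu> \<noteq> 0\<close> of the realification would make the matrix singular at \<open>t = - 1 / \<mu>\<close>.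
\<close>
lemma eq_0_if_det_line_nonzero:
  fixes X :: "quat^'n^'n"
  assumes X: "hyperhermitian X" and det: "\<And>t. det (realification (mat 1 + t *\<^sub>R X)) \<noteq> 0"
  shows "X = 0"
proof (rule ccontr)
  assume "X \<noteq> 0"
  then have "realification X \<noteq> 0" using realification_eq_0D by blast
  then obtain x \<mu> where x: "x \<noteq> 0" "\<mu> \<noteq> 0" "realification X *v x = \<mu> *\<^sub>R x"
    using symmetric_matrix_eigenvector[OF transpose_realification[OF X]] by blast
  define r where "r = - 1 / \<mu>"
  let ?M = "realification (mat 1 + r *\<^sub>R X)"
  have "?M *v x = x + r *\<^sub>R (realification X *v x)"
    by (simp add: realification_add realification_scaleR realification_mat_1
        matrix_vector_mult_add_rdistrib flip: scaleR_matrix_vector_assoc)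
  then have "?M *v x = 0" using x by (simp add: r_def)
  then have "\<not> invertible ?M"
    using x(1) matrix_left_invertible_ker[of ?M] invertible_left_inverse[of ?M] by blast
  then show False using det[of r] by (simp add: invertible_det_nz)
qed

text \<open>
  Replacing all other arguments, \<open>X\<close> annihilates every family of positive definite matrices.  For
  small \<open>t\<close> the arguments of \<open>D(1 + t X, .., 1 + t X)\<close> can then be changed to the identity one by one
  without changing the value.  So the Moore determinant is constant on the line \<open>1 + t X\<close>, first near
  \<open>t = 0\<close> and then everywhere because it is a polynomial in \<open>t\<close>.
\<close>
theorem mixed_discriminant_nondegenerate:
  fixes A :: "nat \<Rightarrow> quat^'n^'n"
  assumes jk: "j \<in> {1..CARD('n)}" "k \<in> {1..CARD('n)}" "j \<noteq> k"
    and A: "positive_definite_except j k A" and X: "hyperhermitian X"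
    and ker: "\<forall>Y. hyperhermitian Y \<longrightarrow> mixed_discriminant (A(j := X, k := Y)) = 0"
  shows "X = 0"
proof -
  let ?I = "{1..CARD('n)}" and ?E = "mat 1 :: quat^'n^'n"
  have one: "hyperhermitian ?E" "positive_definite ?E"
  proof -
    show h: "hyperhermitian ?E" by (rule hyperhermitian_mat_1)
    show "positive_definite ?E" unfolding positive_definite_iff[OF h] realification_mat_1 by simp
  qed
  have slot: "mixed_discriminant (B(i := X)) = 0"
    if i: "i \<in> ?I" and B: "\<forall>l\<in>?I. hyperhermitian (B l) \<and> positive_definite (B l)" for B i
  proof -
    \<comment> \<open>Exchanging the slots \<open>i\<close> and \<open>j\<close> brings \<open>X\<close> to slot \<open>j\<close>.\<close>
    let ?B = "B(i := B j)"
    have "mixed_discriminant (B(i := X)) = mixed_discriminant (?B(j := X, k := ?B k))"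
    proof (cases "i = j")
      case False
      have "mixed_discriminant (B(i := X)) = mixed_discriminant (B(i := X, j := B j))"
        using False by (intro arg_cong[of _ _ mixed_discriminant]) auto
      also have "\<dots> = mixed_discriminant (B(i := B j, j := X))"
        by (rule mixed_discriminant_swap) (use i jk B X False in auto)
      also have "\<dots> = mixed_discriminant (?B(j := X, k := ?B k))"
        using jk by (intro arg_cong[of _ _ mixed_discriminant]) auto
      finally show ?thesis .
    next
      case True
      then show ?thesis using jk by (intro arg_cong[of _ _ mixed_discriminant]) auto
    qed
    also have "\<dots> = 0"
      using B i jk by (intro mixed_discriminant_kernel_all[OF jk A _ X ker]) (auto simp: positive_definite_except_def)
    finally show ?thesis .
  qed
  obtain e where e: "e > 0" "\<And>t. \<bar>t\<bar> \<le> e \<Longrightarrow> positive_definite (?E + t *\<^sub>R X)"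
    using positive_definite_perturb[OF one X] by blast
  obtain c where c: "\<And>A :: quat^'n^'n. hyperhermitian A \<Longrightarrow> mixed_discriminant (\<lambda>_. A) = c * moore_det A"
    using mixed_discriminant_constant_family by blast
  have "mixed_discriminant (\<lambda>_. ?E) \<noteq> 0"
    using mixed_discriminant_hyperbolic(1)[OF jk, of "\<lambda>_. ?E" ?E ?E] one by (simp add: fun_upd_idem positive_definite_except_def)
  then have c0: "c \<noteq> 0" using c[OF one(1)] by auto
  have hyp: "hyperhermitian (?E + t *\<^sub>R X)" for t
    using one X by (simp add: hyperhermitian_add hyperhermitian_scaleR)
  have const: "moore_det (?E + t *\<^sub>R X) = moore_det ?E" if t: "\<bar>t\<bar> \<le> e" for t
  proof -
    define F where "F = (\<lambda>S i :: nat. if i \<in> S then ?E else ?E + t *\<^sub>R X)"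
    have F: "hyperhermitian (F S i) \<and> positive_definite (F S i)" for S i
      using one hyp e(2)[OF t] by (simp add: F_def)
    have "mixed_discriminant (F S) = mixed_discriminant (F {})" if "finite S" "S \<subseteq> ?I" for S
      using that
    proof (induction S)
      case (insert i S)
      have "F S = (F S)(i := 1 *\<^sub>R ?E + t *\<^sub>R X)" using insert.hyps by (auto simp: F_def)
      then have "mixed_discriminant (F S) =
          1 * mixed_discriminant ((F S)(i := ?E)) + t * mixed_discriminant ((F S)(i := X))"
        using mixed_discriminant_linear[of i "F S" ?E X 1 t] insert.prems F one X by simp
      also have "mixed_discriminant ((F S)(i := X)) = 0" using slot[of i "F S"] F insert.prems by auto
      also have "(F S)(i := ?E) = F (insert i S)" by (auto simp: F_def)
      finally show ?case using insert by simp
    qed simp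
    then have "mixed_discriminant (F ?I) = mixed_discriminant (F {})" by blast
    moreover have "mixed_discriminant (F ?I) = mixed_discriminant (\<lambda>_. ?E)"
      by (rule mixed_discriminant_cong) (simp add: F_def)
    moreover have "F {} = (\<lambda>_. ?E + t *\<^sub>R X)" by (simp add: F_def)
    ultimately show ?thesis using c[OF one(1)] c[OF hyp, of t] c0 by simp
  qed
  obtain P :: "quat^'n^'n \<Rightarrow> real" where P: "moore_polynomial P" using ex_moore_polynomial by blast
  then have "real_polynomial_function P" by (simp add: moore_polynomial_def)
  then obtain p where p: "\<And>t. P (?E + t *\<^sub>R X) = poly p t"
    by (rule poly_on_line[of P ?E X]) (rule that)
  have "poly p t = 1" if "\<bar>t\<bar> \<le> e" for t
    using const[OF that] p[of t] moore_det_eq[OF P hyp, of t] moore_det_eq[OF P one(1)] P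
    by (simp add: moore_polynomial_def)
  then have "{0..e} \<subseteq> {t. poly (p - 1) t = 0}" by auto
  moreover have "infinite {0..e}" using e(1) by simp
  ultimately have "p - 1 = 0" using poly_roots_finite finite_subset by blast
  then have "poly p t = 1" for t by simp
  then have "det (realification (?E + t *\<^sub>R X)) = 1" for t
    using P hyp[of t] p[of t] by (simp add: moore_polynomial_def)
  then show ?thesis by (intro eq_0_if_det_line_nonzero[OF X]) simp
qed

theorem corollary1p1p16:
  fixes A :: "nat \<Rightarrow> quat^'n^'n" and X :: "quat^'n^'n" and n :: nat
  assumes n: "n = CARD('n)" "n \<ge> 2"
    and A: "\<And>k. k \<in> {1..n-1} \<Longrightarrow> hyperhermitian (A k)"
           "\<And>k. k \<in> {1..n-1} \<Longrightarrow> positive_definite (A k)"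
    and X: "hyperhermitian X"
  shows "(mixed_discriminant (A(n := X)))\<^sup>2
           \<ge> mixed_discriminant (A(n := A (n-1))) * mixed_discriminant (A(n-1 := X, n := X)) \<and>
         ((mixed_discriminant (A(n := X)))\<^sup>2
           = mixed_discriminant (A(n := A (n-1))) * mixed_discriminant (A(n-1 := X, n := X))
          \<longleftrightarrow> (\<exists>l::real. X = l *\<^sub>R A (n-1)))"
proof -
  define C where "C = A (n - 1)"
  let ?b = "\<lambda>X Y. mixed_discriminant (A(n - 1 := X, n := Y))"
  have jk: "n - 1 \<in> {1..CARD('n)}" "n \<in> {1..CARD('n)}" "n - 1 \<noteq> n" using n by auto
  have C: "hyperhermitian C" "positive_definite C" using A n by (auto simp: C_def)
  have pos: "positive_definite_except (n - 1) n A"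
    unfolding positive_definite_except_def
  proof (intro ballI impI)
    fix i assume "i \<in> {1..CARD('n)}" "i \<noteq> n"
    then have "i \<in> {1..n - 1}" using n by auto
    then show "hyperhermitian (A i) \<and> positive_definite (A i)" using A by blast
  qed
  have A': "\<forall>i\<in>{1..CARD('n)}. i \<noteq> n - 1 \<longrightarrow> i \<noteq> n \<longrightarrow> hyperhermitian (A i)"
    using pos by (simp add: positive_definite_except_def)
  have fold: "A(n := Y) = A(n - 1 := C, n := Y)" for Y by (simp add: C_def)
  have lin: "?b Z (P + r *\<^sub>R Q) = ?b Z P + r * ?b Z Q"
    if "hyperhermitian Z" "hyperhermitian P" "hyperhermitian Q" for Z P Q r
    using mixed_discriminant_linear[of n "A(n - 1 := Z)" P Q 1 r] jk A' that by auto
  note hyperbolic = mixed_discriminant_hyperbolic[OF jk pos C]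
  have CC: "?b C C \<noteq> 0" using hyperbolic(1)[OF X] .
  have "X = l *\<^sub>R C" if eq: "(?b C X)\<^sup>2 = ?b C C * ?b X X" and l: "l = ?b C X / ?b C C" for l
  proof -
    \<comment> \<open>The component of \<open>X\<close> orthogonal to \<open>C\<close>; equality makes it isotropic.\<close>
    let ?X = "X + (- l) *\<^sub>R C"
    have hyp: "hyperhermitian ?X" using X C by (intro hyperhermitian_add hyperhermitian_scaleR)
    have CX: "?b C ?X = 0" using lin[OF C(1) X C(1), of "- l"] CC l by simp
    have "?b C C * ?b ?X ?X = ?b C C * (?b X X - 2 * l * ?b X C + l\<^sup>2 * ?b C C)"
      using mixed_discriminant_add_pair[OF jk A' X C(1), of "- l"] by simp
    also have "?b X C = ?b C X" by (rule mixed_discriminant_swap[OF A' X C(1) jk])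
    also have "?b C C * (?b X X - 2 * l * ?b C X + l\<^sup>2 * ?b C C) = 0"
      using eq CC unfolding l by (simp add: power2_eq_square field_simps)
    finally have "?b ?X ?X = 0" using CC mult_eq_0_iff by blast
    then have "\<forall>Y. hyperhermitian Y \<longrightarrow> ?b ?X Y = 0"
      using mixed_discriminant_kernel[OF jk pos C hyp CX] by blast
    then have "?X = 0" by (rule mixed_discriminant_nondegenerate[OF jk pos hyp])
    then show ?thesis by simp
  qed
  moreover have "(?b C X)\<^sup>2 = ?b C C * ?b X X" if "X = l *\<^sub>R C" for l
  proof -
    have "?b C X = l * ?b C C"
      using mixed_discriminant_linear[of n "A(n - 1 := C)" C C l 0] jk A' C that by auto
    moreover have "?b X X = l * ?b X C"
      using mixed_discriminant_linear[of n "A(n - 1 := X)" C C l 0] jk A' C X that by auto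
    moreover have "?b X C = ?b C X" by (rule mixed_discriminant_swap[OF A' X C(1) jk])
    ultimately show ?thesis by (simp add: power2_eq_square)
  qed
  ultimately show ?thesis
    using hyperbolic(2)[OF X] unfolding fold C_def[symmetric] by blast
qed

end
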